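(* Let $\mathbb{K}=\mathbb{R}$ or $\mathbb{C}$, let $n\ge2$ and $m\ge1$ be integers, let $G=GL(n,\mathbb{K})$, let $P$ be its maximal parabolic subgroup such that $G/P\cong\mathbb{P}^{n-1}\mathbb{K}$, and let $\mathcal{P}=\mathcal{P}_{n,m}$. For any element $F\in G^m/P^m$, there exists a unique element $p_F\in\mathcal{P}$ such that $F$ is $p_F$-constructible, and this induces a (well-defined) surjective map $$\pi\colon\mathrm{diag}(G)\backslash G^m/P^m\to\mathcal{P},\qquad \mathrm{diag}(G)\cdot F\mapsto p_F.$$
   Context: Notation: $\mathbb{N}=\{0,1,2,\ldots\}$; all vector spaces are over $\mathbb{K}$ and finite-dimensional. $\mathrm{diag}(G)\subset G^m$ is the diagonal subgroup. Multiple flags. Let $\mathbf{d}=(r;d^{(1)},\ldots,d^{(m)})$ be non-negative integers with $d^{(i)}\le r$. For an $r$-dimensional vector space $V$, $Fl_{\mathbf{d}}(V)=\prod_{i=1}^m\mathrm{Gr}_{d^{(i)}}(V)$, with elements written $(V;V^{(1)},\ldots,V^{(m)})$, $V^{(i)}\subset V$ of dimension $d^{(i)}$. Such an element is called an $m$-tuple flag of dimension $\mathbf{d}$ (written $\dim D=\mathbf{d}$). Direct sum: $(V;V^{(i)})_i\oplus(W;W^{(i)})_i=(V\oplus W;V^{(i)}\oplus W^{(i)})_i$. Two $m$-tuple flags $(V;V^{(i)})_i$, $(W;W^{(i)})_i$ are isomorphic if there is a linear isomorphism $f\colon V\to W$ with $f(V^{(i)})=W^{(i)}$ for all $i$. An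 $m$-tuple flag is indecomposable if it is not isomorphic to a direct sum of two non-trivial ones (trivial means dimension $(0;0,\ldots,0)$). $G^m/P^m$ is identified with $Fl_{(n;1,\ldots,1)}(\mathbb{K}^n)=(\mathbb{P}^{n-1}\mathbb{K})^m$, with $G$ acting diagonally. For $K\subset\{1,\ldots,m\}$ and $r\in\mathbb{N}$ put $\mathbf{d}(K,r)=(r;\delta_{1,K},\ldots,\delta_{m,K})$, where $\delta_{i,K}=1$ if $i\in K$ and $0$ otherwise. The set $\mathcal{P}_{n,m}$: all tuples $p=(\{I_a\}_{a=1}^{A},\{J_b\}_{b=1}^{B},\{(K_c,r_c)\}_{c=1}^{C})$ (unordered families, each possibly empty) such that $\{1,\ldots,m\}$ is the disjoint union of all the $I_a$, $J_b$, $K_c$; $\#I_a\ge1$, $\#J_b\ge 3$, $r_c\in\mathbb{N}$, $4\le r_c+2\le \#K_c$ for all $a,b,c$; and $0\le r(p)\le n$, where $r(p):=A+\sum_{b=1}^B(\#J_b-1)+\sum_{c=1}^C r_c$. $p$-constructible: for $p=(\{I_a\}_{a=1}^{A},\{J_b\}_{b=1}^{B},\{(K_c,r_c)\}_{c=1}^{C})\in\mathcal{P}_{n,m}$, an $m$-tuple flag $F$ is $p$-constructible if $F$ is isomorphic to $\bigoplus_{k=1}^{n-r(p)}F_{\emptyset,k}\oplus\bigoplus_{a=1}^A F_a\oplus\bigoplus_{b=1}^B D_b\oplus\bigoplus_{c=1}^C E_c$ with all summands indecomposable $m$-tuple flags and $\dim F_{\emptyset,k}=\mathbf{d}(\emptyset,1)$,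 $\dim F_a=\mathbf{d}(I_a,1)$, $\dim D_b=\mathbf{d}(J_b,\#J_b-1)$, $\dim E_c=\mathbf{d}(K_c,r_c)$. *)

theory Defs
  imports
    "HOL-Analysis.Analysis"
    "HOL-Algebra.Left_Coset"
    "HOL-Algebra.Product_Groups"
    "HOL-Library.Function_Algebras"
begin

section \<open>Multiple flags\<close>

text \<open>
  A multiple flag (V; V(1), ..., V(m)) is the pair of V and the family of the V(i); only the
  indices i in {1..m} matter. The spaces are subspaces of an ambient vector space on the type
  'v, whose scalar multiplication s is an explicit argument, since direct sums live on
  product and function types.
\<close>

type_synonym 'v mflag = "'v set \<times> (nat \<Rightarrow> 'v set)"

definition is_mflag :: "('k::field \<Rightarrow> 'v::ab_group_add \<Rightarrow> 'v) \<Rightarrow> nat \<Rightarrow> 'v mflag \<Rightarrow> bool" where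
  "is_mflag s m F \<longleftrightarrow>
     vector_space s \<and> module.subspace s (fst F) \<and>
     (\<exists>B. finite B \<and> module.span s B = fst F) \<and>
     (\<forall>i\<in>{1..m}. module.subspace s (snd F i) \<and> snd F i \<subseteq> fst F)"

definition has_mdim ::
  "('k::field \<Rightarrow> 'v::ab_group_add \<Rightarrow> 'v) \<Rightarrow> nat \<Rightarrow> 'v mflag \<Rightarrow> nat \<times> (nat \<Rightarrow> nat) \<Rightarrow> bool" where
  "has_mdim s m F d \<longleftrightarrow>
     vector_space.dim s (fst F) = fst d \<and>
     (\<forall>i\<in>{1..m}. vector_space.dim s (snd F i) = snd d i)"

definition mflag_iso ::
  "('k::field \<Rightarrow> 'v::ab_group_add \<Rightarrow> 'v) \<Rightarrow> ('k \<Rightarrow> 'w::ab_group_add \<Rightarrow> 'w) \<Rightarrow>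
   nat \<Rightarrow> 'v mflag \<Rightarrow> 'w mflag \<Rightarrow> bool" where
  "mflag_iso s t m F G \<longleftrightarrow>
     (\<exists>f. bij_betw f (fst F) (fst G) \<and>
        (\<forall>x\<in>fst F. \<forall>y\<in>fst F. f (x + y) = f x + f y) \<and>
        (\<forall>c. \<forall>x\<in>fst F. f (s c x) = t c (f x)) \<and>
        (\<forall>i\<in>{1..m}. f ` snd F i = snd G i))"

definition scale_prod :: "('k \<Rightarrow> 'v \<Rightarrow> 'v) \<Rightarrow> 'k \<Rightarrow> 'v \<times> 'v \<Rightarrow> 'v \<times> 'v" where
  "scale_prod s c x = (s c (fst x), s c (snd x))"

definition mflag_sum :: "'v mflag \<Rightarrow> 'v mflag \<Rightarrow> ('v \<times> 'v) mflag" where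
  "mflag_sum F G = (fst F \<times> fst G, \<lambda>i. snd F i \<times> snd G i)"

definition scale_fun :: "('k \<Rightarrow> 'v \<Rightarrow> 'v) \<Rightarrow> 'k \<Rightarrow> ('j \<Rightarrow> 'v) \<Rightarrow> 'j \<Rightarrow> 'v" where
  "scale_fun s c f = (\<lambda>j. s c (f j))"

text \<open>
  Direct sum of the flags X j, for j in the finite index set S. Vectors are families that
  vanish outside S.
\<close>

definition mflag_Sum :: "'j set \<Rightarrow> ('j \<Rightarrow> 'v::zero mflag) \<Rightarrow> ('j \<Rightarrow> 'v) mflag" where
  "mflag_Sum S X =
     ({f. (\<forall>j\<in>S. f j \<in> fst (X j)) \<and> (\<forall>j. j \<notin> S \<longrightarrow> f j = 0)},
      \<lambda>i. {f. (\<forall>j\<in>S. f j \<in> snd (X j) i) \<and> (\<forall>j. j \<notin> S \<longrightarrow> f j = 0)})"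

abbreviation trivial_mflag where
  "trivial_mflag s m F \<equiv> has_mdim s m F (0, \<lambda>i. 0)"

text \<open>
  The direct sums are external. Letting the two summands range over flags in the ambient space
  of F loses nothing: a summand of F, on whatever vector space, embeds into fst F.
\<close>

definition indecomposable_mflag ::
  "('k::field \<Rightarrow> 'v::ab_group_add \<Rightarrow> 'v) \<Rightarrow> nat \<Rightarrow> 'v mflag \<Rightarrow> bool" where
  "indecomposable_mflag s m F \<longleftrightarrow>
     \<not> (\<exists>A B :: 'v mflag. is_mflag s m A \<and> is_mflag s m B \<and>
          \<not> trivial_mflag s m A \<and> \<not> trivial_mflag s m B \<and>
          mflag_iso s (scale_prod s) m F (mflag_sum A B))"

definition dvec :: "nat set \<Rightarrow> nat \<Rightarrow> nat \<times> (nat \<Rightarrow> nat)" where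
  "dvec K r = (r, \<lambda>i. if i \<in> K then 1 else 0)"

section \<open>The index set and constructible flags\<close>

text \<open>
  The three unordered families are encoded as sets. They cannot have repeated members, because
  all the blocks are non-empty and pairwise disjoint.
\<close>

type_synonym ptuple = "nat set set \<times> nat set set \<times> (nat set \<times> nat) set"

fun rk :: "ptuple \<Rightarrow> nat" where
  "rk (Is, Js, Ks) = card Is + (\<Sum>J\<in>Js. card J - 1) + (\<Sum>(K, r)\<in>Ks. r)"

text \<open>
  The disjoint union is one of families, indexed by the disjoint sum of the three index sets:
  a block may not occur both in Is and in Js, nor in Ks with two different r.
\<close>

definition blocks :: "nat set + nat set + nat set \<times> nat \<Rightarrow> nat set" where
  "blocks = case_sum id (case_sum id fst)"

definition PP :: "nat \<Rightarrow> nat \<Rightarrow> ptuple set" where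
  "PP n m = {(Is, Js, Ks).
     disjoint_family_on blocks (Is <+> (Js <+> Ks)) \<and>
     (\<Union>x\<in>Is <+> (Js <+> Ks). blocks x) = {1..m} \<and>
     (\<forall>I\<in>Is. 1 \<le> card I) \<and>
     (\<forall>J\<in>Js. 3 \<le> card J) \<and>
     (\<forall>(K, r)\<in>Ks. 4 \<le> r + 2 \<and> r + 2 \<le> card K) \<and>
     rk (Is, Js, Ks) \<le> n}"

definition indec_of_dim ::
  "('k::field \<Rightarrow> 'v::ab_group_add \<Rightarrow> 'v) \<Rightarrow> nat \<Rightarrow> nat \<times> (nat \<Rightarrow> nat) \<Rightarrow> 'v mflag set" where
  "indec_of_dim s m d = {F. is_mflag s m F \<and> indecomposable_mflag s m F \<and> has_mdim s m F d}"

text \<open>As above, the summands may be taken in the ambient space of F without loss.\<close>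

fun constructible ::
  "('k::field \<Rightarrow> 'v::ab_group_add \<Rightarrow> 'v) \<Rightarrow> nat \<Rightarrow> nat \<Rightarrow> ptuple \<Rightarrow> 'v mflag \<Rightarrow> bool" where
  "constructible s n m (Is, Js, Ks) F \<longleftrightarrow>
     (\<exists>F0 F1 D E.
        (\<forall>k\<in>{1..n - rk (Is, Js, Ks)}. F0 k \<in> indec_of_dim s m (dvec {} 1)) \<and>
        (\<forall>I\<in>Is. F1 I \<in> indec_of_dim s m (dvec I 1)) \<and>
        (\<forall>J\<in>Js. D J \<in> indec_of_dim s m (dvec J (card J - 1))) \<and>
        (\<forall>(K, r)\<in>Ks. E (K, r) \<in> indec_of_dim s m (dvec K r)) \<and>
        mflag_iso s (scale_fun s) m F
          (mflag_Sum ({1..n - rk (Is, Js, Ks)} <+> (Is <+> (Js <+> Ks)))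
             (case_sum F0 (case_sum F1 (case_sum D E)))))"

section \<open>The group GL(n, K) and its products of projective spaces\<close>

definition GL :: "('k::field^'n^'n) monoid" where
  "GL = \<lparr>carrier = {A. invertible A}, mult = (**), one = mat 1\<rparr>"

text \<open>
  The maximal parabolic subgroups P for which G/P is the space of lines are the stabilizers of
  the lines L.
\<close>

definition Par :: "('k::field^'n) set \<Rightarrow> ('k^'n^'n) set" where
  "Par L = {A \<in> carrier GL. (*v) A ` L = L}"

abbreviation is_line :: "('k::field^'n) set \<Rightarrow> bool" where
  "is_line L \<equiv> vec.subspace L \<and> vec.dim L = 1"

definition GLm :: "nat \<Rightarrow> (nat \<Rightarrow> 'k::field^'n^'n) monoid" where
  "GLm m = product_group {1..m} (\<lambda>_. GL)"

definition diagGL :: "nat \<Rightarrow> (nat \<Rightarrow> 'k::field^'n^'n) set" where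
  "diagGL m = (\<lambda>A. \<lambda>i\<in>{1..m}. A) ` carrier GL"

definition GmPm :: "nat \<Rightarrow> ('k::field^'n) set \<Rightarrow> (nat \<Rightarrow> 'k^'n^'n) set set" where
  "GmPm m L = lcosets\<^bsub>GLm m\<^esub> (\<Pi>\<^sub>E i\<in>{1..m}. Par L)"

text \<open>The orbit diag(G) F of a coset F, as the double coset that is the union of the orbit.\<close>

definition diag_orbit :: "nat \<Rightarrow> (nat \<Rightarrow> 'k::field^'n^'n) set \<Rightarrow> (nat \<Rightarrow> 'k^'n^'n) set" where
  "diag_orbit m F = diagGL m <#>\<^bsub>GLm m\<^esub> F"

definition diag_quot :: "nat \<Rightarrow> ('k::field^'n) set \<Rightarrow> (nat \<Rightarrow> 'k^'n^'n) set set" where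
  "diag_quot m L = diag_orbit m ` GmPm m L"

text \<open>
  The coset of (g(1), ..., g(m)) corresponds to the flag (K^n; g(1) L, ..., g(m) L). The union
  below is over equal lines, since the entries of P^m stabilize L.
\<close>

definition coset_mflag ::
  "('k::field^'n) set \<Rightarrow> (nat \<Rightarrow> 'k^'n^'n) set \<Rightarrow> ('k^'n) mflag" where
  "coset_mflag L F = (UNIV, \<lambda>i. \<Union>g\<in>F. (*v) (g i) ` L)"

end

theory Submission
  imports Defs "HOL-Computational_Algebra.Polynomial"
begin

text \<open>
  Choose a vector v(i) spanning the i-th line. In a direct sum decomposition of the flag each line
  lies in exactly one summand, so decompositions correspond to partitions of {1..m} into sets to
  which every linear relation between the v(i) restricts (separators). A summand is indecomposable
  exactly if its vectors span it and its index set has no proper non-empty separator. Hence the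
  blocks of p are the minimal non-empty separators and their types are read off from their rank and
  cardinality: a minimal separator of rank at least 2 has fewer dimensions than elements, as
  otherwise its vectors would be independent and singletons would separate. This determines p.
\<close>

section \<open>Separators of a family of vectors\<close>

text \<open>Uniqueness of indecomposable summands is usually a Krull-Schmidt argument on
  endomorphism rings. Here it is combinatorial: separators are closed under complements and
  intersections, so the minimal non-empty ones are disjoint and cover {1..m}. Summands without lines
  are invisible to separators; only their number matters, and n forces it. Relations rather than
  ranks define separators because a flag isomorphism carries relations over coordinate by
  coordinate, and ranks then follow. All families are indexed by {1..m} instead of being sets of
  vectors, since lines may coincide; in a block of rank 1 they all do. Surjectivity is a separate
  matter: each block of rank r and size k needs k non-zero vectors that span r dimensions and admit
  no proper separator. This is possible if r = 1 or r < k, which is what the three types of blocks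
  encode, and it is achieved by vectors any r of which are independent.\<close>

locale flag_space = finite_dimensional_vector_space scale Basis
  for scale :: "'a::field \<Rightarrow> 'b::ab_group_add \<Rightarrow> 'b" and Basis
begin

text \<open>
  A separator in the sense of matroid theory, stated through linear relations rather than ranks:
  every relation on M restricts to a relation on T.
\<close>

definition separator :: "('i \<Rightarrow> 'b) \<Rightarrow> 'i set \<Rightarrow> 'i set \<Rightarrow> bool" where
  "separator v M T \<longleftrightarrow> T \<subseteq> M \<and>
     (\<forall>c. (\<Sum>i\<in>M. scale (c i) (v i)) = 0 \<longrightarrow> (\<Sum>i\<in>T. scale (c i) (v i)) = 0)"

definition connected_family :: "('i \<Rightarrow> 'b) \<Rightarrow> 'i set \<Rightarrow> bool" where
  "connected_family v S \<longleftrightarrow> (\<forall>T. separator v S T \<longrightarrow> T = {} \<or> T = S)"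

text \<open>Unlike \<open>independent\<close> of the image set, this notion counts a repeated vector
  as a dependence.\<close>

definition independent_family :: "('i \<Rightarrow> 'b) \<Rightarrow> 'i set \<Rightarrow> bool" where
  "independent_family v S \<longleftrightarrow>
     (\<forall>c. (\<Sum>i\<in>S. scale (c i) (v i)) = 0 \<longrightarrow> (\<forall>i\<in>S. c i = 0))"

lemma separatorD:
  "separator v M T \<Longrightarrow> (\<Sum>i\<in>M. scale (c i) (v i)) = 0 \<Longrightarrow> (\<Sum>i\<in>T. scale (c i) (v i)) = 0"
  by (auto simp: separator_def)

lemma separator_subset: "separator v M T \<Longrightarrow> T \<subseteq> M"
  by (simp add: separator_def)

lemma separator_refl: "separator v M M"
  by (simp add: separator_def)

lemma separator_Diff:
  assumes "finite M" "separator v M T"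
  shows "separator v M (M - T)"
proof -
  have "(\<Sum>i\<in>M - T. scale (c i) (v i)) = (\<Sum>i\<in>M. scale (c i) (v i)) - (\<Sum>i\<in>T. scale (c i) (v i))" for c
    using assms by (simp add: sum_diff separator_def)
  with assms(2) show ?thesis by (simp add: separator_def)
qed

lemma separator_trans:
  assumes "separator v M S" "separator v S T"
  shows "separator v M T"
  using assms by (fastforce simp: separator_def)

text \<open>A relation on S, extended by zero coefficients, is a relation on M; restricting that to
  T leaves the terms over the intersection.\<close>

lemma separator_Int:
  assumes "finite M" "separator v M T" "S \<subseteq> M"
  shows "separator v S (T \<inter> S)"
  unfolding separator_def
proof (intro conjI allI impI)
  fix c assume c: "(\<Sum>i\<in>S. scale (c i) (v i)) = 0"
  let ?c = "\<lambda>i. if i \<in> S then c i else 0"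
  have e: "(\<Sum>i\<in>A. scale (?c i) (v i)) = (\<Sum>i\<in>A \<inter> S. scale (c i) (v i))" if "A \<subseteq> M" for A
    using finite_subset[OF that assms(1)]
    by (simp add: if_distrib[of "\<lambda>x. scale x _"] sum.inter_restrict cong: if_cong)
  have "(\<Sum>i\<in>M. scale (?c i) (v i)) = 0"
    using e[of M] c assms(3) by (simp add: Int_absorb1)
  from separatorD[OF assms(2) this] e[of T] separator_subset[OF assms(2)]
  show "(\<Sum>i\<in>T \<inter> S. scale (c i) (v i)) = 0" by simp
qed auto

text \<open>Coefficients are attached to indices, which works even when v is not injective: a
  further multiple of v i is absorbed into the coefficient at i.\<close>

lemma span_image_finite:
  assumes "finite S"
  shows "span (v ` S) = range (\<lambda>c. \<Sum>i\<in>S. scale (c i) (v i))"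
proof (intro equalityI subsetI)
  fix x assume "x \<in> span (v ` S)"
  then show "x \<in> range (\<lambda>c. \<Sum>i\<in>S. scale (c i) (v i))"
  proof (induction rule: span_induct_alt)
    case base
    show ?case by (rule range_eqI[of _ _ "\<lambda>_. 0"]) simp
  next
    case (step a x y)
    then obtain i c where i: "i \<in> S" "x = v i" "y = (\<Sum>i\<in>S. scale (c i) (v i))" by auto
    let ?c = "\<lambda>j. c j + (if j = i then a else 0)"
    have "(\<Sum>j\<in>S. scale (?c j) (v j)) = y + (\<Sum>j\<in>S. if j = i then scale a (v i) else 0)"
      unfolding i sum.distrib[symmetric] by (rule sum.cong) (auto simp: scale_left_distrib)
    also have "\<dots> = scale a x + y" using i assms by (simp add: add.commute)
    finally have "scale a x + y = (\<Sum>j\<in>S. scale (?c j) (v j))" by simp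
    then show ?case by (intro image_eqI[where x = ?c]) simp_all
  qed
next
  fix x assume "x \<in> range (\<lambda>c. \<Sum>i\<in>S. scale (c i) (v i))"
  then show "x \<in> span (v ` S)" by (auto intro!: span_sum intro: span_scale span_base)
qed

text \<open>Two expressions for x, one over S and one over T, subtract to a relation on their union.
  The half over S of this relation is x itself, and it vanishes because S separates. T itself may be
  any set disjoint from S.\<close>

lemma separator_span_Int:
  assumes "finite M" "separator v M S" "T \<subseteq> M" "S \<inter> T = {}"
    and "x \<in> span (v ` S)" "x \<in> span (v ` T)"
  shows "x = 0"
proof -
  have fin: "finite S" "finite T" using assms finite_subset separator_subset by metis+
  obtain c where c: "x = (\<Sum>i\<in>S. scale (c i) (v i))"
    using assms(5) span_image_finite[OF fin(1)] by auto
  obtain d where d: "x = (\<Sum>i\<in>T. scale (d i) (v i))"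
    using assms(6) span_image_finite[OF fin(2)] by auto
  let ?c = "\<lambda>i. if i \<in> S then c i else - d i"
  have "separator v (S \<union> T) (S \<inter> (S \<union> T))"
    using assms separator_subset[OF assms(2)] by (intro separator_Int) auto
  moreover have "(\<Sum>i\<in>S \<union> T. scale (?c i) (v i)) = x - x"
  proof -
    have "(\<Sum>i\<in>T. scale (?c i) (v i)) = (\<Sum>i\<in>T. - scale (d i) (v i))"
      using assms(4) by (intro sum.cong) auto
    then show ?thesis
      using fin assms(4) by (simp add: sum.union_disjoint c[symmetric] d[symmetric] sum_negf)
  qed
  ultimately have "(\<Sum>i\<in>S \<inter> (S \<union> T). scale (?c i) (v i)) = 0" by (auto dest: separatorD)
  then show ?thesis using c by simp
qed

text \<open>A basis is chosen among the vectors, then one index for each basis vector. This is the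
  bridge from \<open>dim\<close> to indexed families.\<close>

lemma independent_family_subset_rank:
  assumes "finite S"
  obtains C where "C \<subseteq> S" "independent_family v C" "card C = dim (v ` S)"
proof -
  obtain B where B: "B \<subseteq> v ` S" "independent B" "card B = dim (v ` S)"
    using basis_exists by metis
  then obtain C where C: "C \<subseteq> S" "inj_on v C" "B = v ` C"
    by (auto simp: subset_image_inj)
  have "finite C" using assms C finite_subset by blast
  have "independent_family v C"
    unfolding independent_family_def
  proof (intro allI impI ballI)
    fix c i assume c: "(\<Sum>i\<in>C. scale (c i) (v i)) = 0" and i: "i \<in> C"
    have "(\<Sum>x\<in>B. scale (c (inv_into C v x)) x) = 0"
      using C c by (simp add: sum.reindex)
    then have "c (inv_into C v (v i)) = 0"
      using i C \<open>finite C\<close> by (intro independentD[OF B(2) _ subset_refl]) auto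
    then show "c i = 0" using C i by simp
  qed
  with that B C show thesis by (metis card_image)
qed

lemma independent_family_separator:
  assumes "finite S" "independent_family v S" "T \<subseteq> S"
  shows "separator v S T"
  using assms by (auto simp: separator_def independent_family_def intro!: sum.neutral)

text \<open>A separator of M of least size containing i is connected: of any separator of it and the
  complement, one contains i and again separates M, so minimality makes it everything.\<close>

lemma connected_separator_exists:
  assumes "finite M" "i \<in> M"
  obtains S where "i \<in> S" "separator v M S" "connected_family v S"
proof -
  obtain S where S: "i \<in> S \<and> separator v M S"
    and min: "\<And>T. i \<in> T \<and> separator v M T \<Longrightarrow> card S \<le> card T"
    using ex_has_least_nat[of "\<lambda>S. i \<in> S \<and> separator v M S" M card] assms separator_refl by blast
  have fin: "finite S" using S assms finite_subset separator_subset by metis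
  have *: "T = S" if "i \<in> T" "separator v S T" for T
    using that min[of T] S separator_trans card_seteq[OF fin] separator_subset by metis
  have "T = {} \<or> T = S" if T: "separator v S T" for T
  proof (cases "i \<in> T")
    case False
    then have "S - T = S" using * S separator_Diff[OF fin T] by blast
    then show ?thesis using separator_subset[OF T] by blast
  qed (use * T in blast)
  with that S show thesis by (auto simp: connected_family_def)
qed

text \<open>The intersection separates both sets, hence is empty or equal to each of them. All
  uniqueness statements rest on this.\<close>

lemma connected_separators_disjoint:
  assumes "finite M" "separator v M S" "connected_family v S" "separator v M T" "connected_family v T"
  shows "S = T \<or> S \<inter> T = {}"
proof -
  have "separator v S (T \<inter> S)" "separator v T (S \<inter> T)"
    using separator_Int[OF assms(1,4) separator_subset[OF assms(2)]]
      separator_Int[OF assms(1,2) separator_subset[OF assms(4)]] by simp_all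
  with assms show ?thesis unfolding connected_family_def by blast
qed

section \<open>Ranks of families and their additivity over separators\<close>

lemma independent_family_rank:
  assumes "finite S" "independent_family v S"
  shows "dim (v ` S) = card S"
proof -
  have inj: "inj_on v S"
  proof (rule inj_onI, rule ccontr)
    fix i j assume ij: "i \<in> S" "j \<in> S" "v i = v j" "i \<noteq> j"
    \<comment> \<open>If two indices share a vector, the difference of their indicator functions is
      a non-trivial relation.\<close>
    let ?c = "\<lambda>k. (if k = i then 1 else 0) - (if k = j then 1 else 0) :: 'a"
    have "(\<Sum>k\<in>S. scale (?c k) (v k)) = 0"
      using ij assms
      by (simp add: scale_left_diff_distrib sum_subtractf if_distrib[of "\<lambda>x. scale x _"] cong: if_cong)
    from assms(2)[unfolded independent_family_def, rule_format, OF this ij(1)] ij(4)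
    show False by simp
  qed
  have "independent (v ` S)"
  proof (rule independent_if_scalars_zero)
    fix f x assume f: "(\<Sum>x\<in>v ` S. scale (f x) x) = 0" and x: "x \<in> v ` S"
    have "(\<Sum>i\<in>S. scale (f (v i)) (v i)) = 0" using f inj by (simp add: sum.reindex)
    with assms(2) x show "f x = 0" unfolding independent_family_def by auto
  qed (use assms in simp)
  then show ?thesis using inj by (simp add: dim_eq_card_independent card_image)
qed

text \<open>If every relation of w holds for v, indices independent for v stay independent for w.
  Applied in both directions, it equates the rank of a block with that of its image in a
  summand.\<close>

lemma rank_mono_relations:
  assumes "finite S"
    and "\<And>c. (\<Sum>i\<in>S. scale (c i) (w i)) = 0 \<Longrightarrow> (\<Sum>i\<in>S. scale (c i) (v i)) = 0"
  shows "dim (v ` S) \<le> dim (w ` S)"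
proof -
  obtain C where C: "C \<subseteq> S" "independent_family v C" "card C = dim (v ` S)"
    using independent_family_subset_rank[OF assms(1)] .
  have fC: "finite C" using C assms finite_subset by blast
  have "independent_family w C"
    unfolding independent_family_def
  proof (intro allI impI)
    fix c assume c: "(\<Sum>i\<in>C. scale (c i) (w i)) = 0"
    let ?c = "\<lambda>i. if i \<in> C then c i else 0"
    have e: "(\<Sum>i\<in>S. scale (?c i) (u i)) = (\<Sum>i\<in>C. scale (c i) (u i))" for u
      using assms(1) C(1)
      by (simp add: if_distrib[of "\<lambda>x. scale x _"] sum.inter_restrict[symmetric] Int_absorb1 cong: if_cong)
    have "(\<Sum>i\<in>S. scale (?c i) (v i)) = 0" using assms(2)[of ?c] e[of w] c by simp
    then show "\<forall>i\<in>C. c i = 0" using e[of v] C(2) unfolding independent_family_def by simp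
  qed
  then have "card C = dim (w ` C)" by (rule independent_family_rank[OF fC, symmetric])
  also have "\<dots> \<le> dim (w ` S)" using C(1) by (intro dim_subset) auto
  finally show ?thesis using C(3) by simp
qed

lemma rank_le_card: "finite S \<Longrightarrow> dim (v ` S) \<le> card S"
  by (meson card_image_le dim_le_card finite_imageI le_trans span_superset)

lemma rank_eq_card_imp_independent_family:
  assumes "finite S" "dim (v ` S) = card S"
  shows "independent_family v S"
proof -
  obtain C where C: "C \<subseteq> S" "independent_family v C" "card C = dim (v ` S)"
    using independent_family_subset_rank[OF assms(1)] .
  then show ?thesis using card_subset_eq[OF assms(1), of C] assms(2) by simp
qed

text \<open>The two spans meet only in 0, so the dimension formula for sums of subspaces has no
  correction term.\<close>

lemma rank_separator_Un:
  assumes "finite M" "separator v M S" "T \<subseteq> M" "S \<inter> T = {}"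
  shows "dim (v ` (S \<union> T)) = dim (v ` S) + dim (v ` T)"
proof -
  have "span (v ` S) \<inter> span (v ` T) = {0}"
    using separator_span_Int[OF assms] by (auto simp: span_zero)
  moreover have "dim {x + y |x y. x \<in> span (v ` S) \<and> y \<in> span (v ` T)}
      + dim (span (v ` S) \<inter> span (v ` T)) = dim (span (v ` S)) + dim (span (v ` T))"
    by (intro dim_sums_Int subspace_span)
  ultimately have "dim (span (v ` S \<union> v ` T)) = dim (v ` S) + dim (v ` T)"
    unfolding span_Un by simp
  then show ?thesis by (simp add: image_Un)
qed

lemma rank_separator_UN:
  assumes "finite M" "finite J" "\<And>j. j \<in> J \<Longrightarrow> separator v M (B j)" "disjoint_family_on B J"
  shows "dim (v ` (\<Union>j\<in>J. B j)) = (\<Sum>j\<in>J. dim (v ` B j))"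
  using assms(2-)
proof (induction J rule: finite_induct)
  case (insert j J)
  have "dim (v ` (B j \<union> (\<Union>j\<in>J. B j))) = dim (v ` B j) + dim (v ` (\<Union>j\<in>J. B j))"
  proof (rule rank_separator_Un[OF assms(1)])
    show "B j \<inter> \<Union> (B ` J) = {}"
      using insert by (fastforce simp: disjoint_family_on_def)
  qed (use insert separator_subset in fastforce)+
  moreover have "disjoint_family_on B J" using insert by (auto simp: disjoint_family_on_def)
  ultimately show ?case using insert by simp
qed simp

text \<open>Full rank means independence; then every subset separates and connectedness leaves a
  single index. Splitting the second alternative into equality and strict inequality yields the
  three types of blocks.\<close>

lemma connected_family_rank:
  assumes "finite S" "S \<noteq> {}" "connected_family v S" "\<And>i. i \<in> S \<Longrightarrow> v i \<noteq> 0"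
  shows "dim (v ` S) = 1 \<or> 2 \<le> dim (v ` S) \<and> dim (v ` S) + 1 \<le> card S"
proof -
  have "dim (v ` S) \<noteq> 0" using assms by auto
  moreover have "dim (v ` S) = 1" if "dim (v ` S) = card S"
  proof -
    obtain i where i: "i \<in> S" using assms by blast
    have "separator v S {i}"
      using i by (intro independent_family_separator rank_eq_card_imp_independent_family assms that) auto
    with assms(3) have "S = {i}" unfolding connected_family_def by blast
    then show ?thesis using assms(4) by simp
  qed
  ultimately show ?thesis using rank_le_card[OF assms(1), of v] by linarith
qed

text \<open>The complement has to contain the prescribed W, since it must hold the lines that do not
  go into A. A subspace of largest dimension among those containing W and meeting A trivially
  already complements A.\<close>

lemma complement_exists:
  assumes "subspace A" "subspace V" "subspace W" "W \<subseteq> V" "A \<subseteq> V" "A \<inter> W = {0}"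
  obtains B where "subspace B" "W \<subseteq> B" "B \<subseteq> V" "A \<inter> B = {0}" "\<forall>x\<in>V. \<exists>a\<in>A. \<exists>b\<in>B. x = a + b"
proof -
  define P where "P B \<longleftrightarrow> subspace B \<and> W \<subseteq> B \<and> B \<subseteq> V \<and> A \<inter> B = {0}" for B
  have "P W" using assms by (simp add: P_def)
  moreover have "\<forall>B. P B \<longrightarrow> dim B < Suc (dim V)"
    by (auto simp: less_Suc_eq_le P_def intro: dim_subset)
  ultimately obtain B where "P B" and max: "\<And>C. P C \<Longrightarrow> dim C \<le> dim B"
    using ex_has_greatest_nat[of P W dim "Suc (dim V)"] by blast
  then have B: "subspace B" "W \<subseteq> B" "B \<subseteq> V" "A \<inter> B = {0}" by (simp_all add: P_def)
  have "\<exists>a\<in>A. \<exists>b\<in>B. x = a + b" if x: "x \<in> V" for x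
  proof (rule ccontr)
    assume no: "\<not> ?thesis"
    have "x \<notin> B" using no subspace_0[OF assms(1)] by force
    let ?C = "span (insert x B)"
    have PC: "P ?C"
      unfolding P_def
    proof (intro conjI)
      show "W \<subseteq> ?C" using B by (meson order_trans span_superset subset_insertI)
      show "?C \<subseteq> V" using B x assms by (intro span_minimal) auto
      have "y = 0" if y: "y \<in> A" "y \<in> ?C" for y
      proof -
        obtain k where "y - scale k x \<in> span B" using y span_breakdown_eq by blast
        then have k: "y - scale k x \<in> B" using B by (metis span_eq_iff)
        \<comment> \<open>Here y = k x + b with b in B; dividing by a non-zero k would put x into A
          + B.\<close>
        have "k = 0"
        proof (rule ccontr)
          assume "k \<noteq> 0"
          then have "x = scale (inverse k) y + scale (- inverse k) (y - scale k x)"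
            by (simp add: scale_right_diff_distrib)
          moreover have "scale (inverse k) y \<in> A" "scale (- inverse k) (y - scale k x) \<in> B"
            using y k B assms(1) subspace_scale by blast+
          ultimately show False using no by blast
        qed
        then show "y = 0" using k B y by auto
      qed
      then show "A \<inter> ?C = {0}" using assms(1) subspace_0 span_zero by blast
    qed simp
    have "x \<notin> span B" using \<open>x \<notin> B\<close> span_eq_iff[THEN iffD2, OF B(1)] by metis
    then have "dim ?C = dim B + 1" by (simp only: dim_span dim_insert if_False)
    with max[OF PC] show False by linarith
  qed
  then have "\<forall>x\<in>V. \<exists>a\<in>A. \<exists>b\<in>B. x = a + b" by blast
  then show thesis by (rule that[OF B])
qed

end

section \<open>Indecomposable flags\<close>

text \<open>The map g runs backwards, from G to F: for a direct sum G it is then simply addition of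
  components, and no projections have to be written down. Closure of \<open>fst G\<close> is
  required because the inverse of g is only controlled on the image of that set.\<close>

lemma mflag_isoI:
  assumes bij: "bij_betw g (fst G) (fst F)"
    and add: "\<And>x y. x \<in> fst G \<Longrightarrow> y \<in> fst G \<Longrightarrow> x + y \<in> fst G \<and> g (x + y) = g x + g y"
    and scale: "\<And>c x. x \<in> fst G \<Longrightarrow> t c x \<in> fst G \<and> g (t c x) = s c (g x)"
    and img: "\<And>i. i \<in> {1..m} \<Longrightarrow> snd G i \<subseteq> fst G \<and> g ` snd G i = snd F i"
  shows "mflag_iso s t m F G"
proof -
  let ?f = "inv_into (fst G) g"
  have inj: "inj_on g (fst G)" and im: "g ` fst G = fst F" using bij by (auto simp: bij_betw_def)
  have f: "?f x \<in> fst G" "g (?f x) = x" if "x \<in> fst F" for x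
    using that im inv_into_into[of x g "fst G"] f_inv_into_f[of x g "fst G"] by simp_all
  have "?f (x + y) = ?f x + ?f y" if xy: "x \<in> fst F" "y \<in> fst F" for x y
    using f[OF xy(1)] f[OF xy(2)] add[of "?f x" "?f y"] inv_into_f_f[OF inj, of "?f x + ?f y"] by simp
  moreover have "?f (s c x) = t c (?f x)" if x: "x \<in> fst F" for c x
    using f[OF x] scale[of "?f x" c] inv_into_f_f[OF inj, of "t c (?f x)"] by simp
  moreover have "?f ` snd F i = snd G i" if "i \<in> {1..m}" for i
    using img[OF that] inj by (metis inv_into_image_cancel)
  ultimately show ?thesis
    unfolding mflag_iso_def using bij_betw_inv_into[OF bij] by blast
qed

lemma mflag_iso_trans:
  assumes "mflag_iso s t m F G" "mflag_iso t u m G H"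
    and "\<And>i. i \<in> {1..m} \<Longrightarrow> snd F i \<subseteq> fst F"
  shows "mflag_iso s u m F H"
proof -
  obtain f g where f: "bij_betw f (fst F) (fst G)"
    "\<forall>x\<in>fst F. \<forall>y\<in>fst F. f (x + y) = f x + f y" "\<forall>c. \<forall>x\<in>fst F. f (s c x) = t c (f x)"
    "\<forall>i\<in>{1..m}. f ` snd F i = snd G i"
    using assms(1) unfolding mflag_iso_def by (elim exE conjE) (rule that)
  obtain g where g: "bij_betw g (fst G) (fst H)"
    "\<forall>x\<in>fst G. \<forall>y\<in>fst G. g (x + y) = g x + g y" "\<forall>c. \<forall>x\<in>fst G. g (t c x) = u c (g x)"
    "\<forall>i\<in>{1..m}. g ` snd G i = snd H i"
    using assms(2) unfolding mflag_iso_def by (elim exE conjE) (rule that)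
  have "f x \<in> fst G" if "x \<in> fst F" for x using f(1) that by (auto simp: bij_betw_def)
  moreover have "(g \<circ> f) ` snd F i = snd H i" if "i \<in> {1..m}" for i
    unfolding image_comp[symmetric] using f(4) g(4) that by simp
  ultimately have "bij_betw (g \<circ> f) (fst F) (fst H) \<and>
      (\<forall>x\<in>fst F. \<forall>y\<in>fst F. (g \<circ> f) (x + y) = (g \<circ> f) x + (g \<circ> f) y) \<and>
      (\<forall>c. \<forall>x\<in>fst F. (g \<circ> f) (s c x) = u c ((g \<circ> f) x)) \<and>
      (\<forall>i\<in>{1..m}. (g \<circ> f) ` snd F i = snd H i)"
    using f(2,3) g(2,3) bij_betw_trans[OF f(1) g(1)] by simp
  then show ?thesis unfolding mflag_iso_def by blast
qed

section \<open>Coordinate maps of a decomposition and indecomposability\<close>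

context flag_space
begin

text \<open>Linearity is asked only on V, because a flag isomorphism is unconstrained outside the
  space of the flag.\<close>

definition hom_on :: "'b set \<Rightarrow> ('b \<Rightarrow> 'b) \<Rightarrow> bool" where
  "hom_on V \<phi> \<longleftrightarrow> (\<forall>x\<in>V. \<forall>y\<in>V. \<phi> (x + y) = \<phi> x + \<phi> y) \<and> (\<forall>c. \<forall>x\<in>V. \<phi> (scale c x) = scale c (\<phi> x))"

lemma hom_on_sum:
  assumes "subspace V" "hom_on V \<phi>" "\<And>i. i \<in> S \<Longrightarrow> v i \<in> V"
  shows "\<phi> (\<Sum>i\<in>S. scale (c i) (v i)) = (\<Sum>i\<in>S. scale (c i) (\<phi> (v i)))"
proof -
  have "\<phi> (scale 0 0) = scale 0 (\<phi> 0)"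
    using assms(2) subspace_0[OF assms(1)] unfolding hom_on_def by blast
  then have "\<phi> 0 = 0" by simp
  then show ?thesis
    using assms(3)
  proof (induction S rule: infinite_finite_induct)
    case (insert i S)
    then have "scale (c i) (v i) \<in> V" "(\<Sum>i\<in>S. scale (c i) (v i)) \<in> V"
      using assms(1) by (auto intro!: subspace_sum subspace_scale)
    then show ?case using insert assms(2) by (simp add: hom_on_def)
  qed auto
qed

lemma hom_on_span_eq_0:
  assumes "subspace V" "hom_on V \<phi>" "finite S" "\<And>i. i \<in> S \<Longrightarrow> v i \<in> V \<and> \<phi> (v i) = 0"
    and "x \<in> span (v ` S)"
  shows "\<phi> x = 0"
proof -
  obtain c where "x = (\<Sum>i\<in>S. scale (c i) (v i))"
    using assms(5) span_image_finite[OF assms(3)] by auto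
  then show ?thesis using hom_on_sum[OF assms(1,2), of S v c] assms(4) by simp
qed

lemma is_mflag_iff:
  "is_mflag scale m F \<longleftrightarrow> subspace (fst F) \<and> (\<forall>i\<in>{1..m}. subspace (snd F i) \<and> snd F i \<subseteq> fst F)"
proof -
  have "\<exists>B. finite B \<and> span B = fst F" if "subspace (fst F)"
    using basis_exists[of "fst F"] that by (metis finiteI_independent span_subspace)
  then show ?thesis using vector_space_axioms by (auto simp: is_mflag_def)
qed

text \<open>\<phi> and \<psi> are the two components of an isomorphism onto a direct sum A + B. The
  vector y is the preimage of (\<phi> x, 0), which exists because the space and each of its marked
  subspaces map onto products. A component that vanishes identically means a trivial
  summand.\<close>

lemma indecomposableI:
  assumes "subspace (fst F)"
    and split: "\<And>\<phi> \<psi>. hom_on (fst F) \<phi> \<Longrightarrow> hom_on (fst F) \<psi> \<Longrightarrow>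
      (\<And>x. x \<in> fst F \<Longrightarrow> \<phi> x = 0 \<Longrightarrow> \<psi> x = 0 \<Longrightarrow> x = 0) \<Longrightarrow>
      (\<And>x. x \<in> fst F \<Longrightarrow> \<exists>y\<in>fst F. \<phi> y = \<phi> x \<and> \<psi> y = 0) \<Longrightarrow>
      (\<And>i x. i \<in> {1..m} \<Longrightarrow> x \<in> snd F i \<Longrightarrow> \<exists>y\<in>snd F i. \<phi> y = \<phi> x \<and> \<psi> y = 0) \<Longrightarrow>
      (\<forall>x\<in>fst F. \<phi> x = 0) \<or> (\<forall>x\<in>fst F. \<psi> x = 0)"
  shows "indecomposable_mflag scale m F"
  unfolding indecomposable_mflag_def
proof
  assume "\<exists>A B :: 'b mflag. is_mflag scale m A \<and> is_mflag scale m B \<and>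
          \<not> trivial_mflag scale m A \<and> \<not> trivial_mflag scale m B \<and>
          mflag_iso scale (scale_prod scale) m F (mflag_sum A B)"
  then obtain A B :: "'b mflag" where A: "is_mflag scale m A" "\<not> trivial_mflag scale m A"
    and B: "is_mflag scale m B" "\<not> trivial_mflag scale m B"
    and "mflag_iso scale (scale_prod scale) m F (mflag_sum A B)" by (elim exE conjE) rule
  then obtain f where bij: "bij_betw f (fst F) (fst A \<times> fst B)"
    and add: "\<And>x y. x \<in> fst F \<Longrightarrow> y \<in> fst F \<Longrightarrow> f (x + y) = f x + f y"
    and sc: "\<And>c x. x \<in> fst F \<Longrightarrow> f (scale c x) = scale_prod scale c (f x)"
    and lines: "\<And>i. i \<in> {1..m} \<Longrightarrow> f ` snd F i = snd A i \<times> snd B i"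
    unfolding mflag_iso_def mflag_sum_def fst_conv snd_conv by (elim exE conjE) (rule that, blast+)
  have im: "f ` fst F = fst A \<times> fst B" and inj: "inj_on f (fst F)"
    using bij by (auto simp: bij_betw_def)
  have nontrivial: "\<exists>x\<in>fst C. x \<noteq> 0" if "is_mflag scale m C" "\<not> trivial_mflag scale m C" for C :: "'b mflag"
  proof (rule ccontr)
    assume "\<not> ?thesis"
    then have "fst C \<subseteq> {0}" by blast
    moreover then have "\<forall>i\<in>{1..m}. snd C i \<subseteq> {0}" using that(1) unfolding is_mflag_iff by blast
    ultimately show False using that(2) by (simp add: has_mdim_def)
  qed
  have A0: "0 \<in> fst A" and B0: "0 \<in> fst B" "\<And>i. i \<in> {1..m} \<Longrightarrow> 0 \<in> snd B i"
    using A(1) B(1) unfolding is_mflag_iff by (auto intro: subspace_0)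
  have F0: "0 \<in> fst F" using assms(1) by (rule subspace_0)
  then have f0: "f 0 = (0, 0)" using sc[of 0 0] by (simp add: scale_prod_def)
  have "(\<forall>x\<in>fst F. fst (f x) = 0) \<or> (\<forall>x\<in>fst F. snd (f x) = 0)"
  proof (rule split)
    show "hom_on (fst F) (\<lambda>x. fst (f x))" "hom_on (fst F) (\<lambda>x. snd (f x))"
      by (simp_all add: hom_on_def add sc scale_prod_def)
    show "x = 0" if "x \<in> fst F" "fst (f x) = 0" "snd (f x) = 0" for x
      using that f0 F0 inj by (metis inj_onD prod.collapse)
    show "\<exists>y\<in>fst F. fst (f y) = fst (f x) \<and> snd (f y) = 0" if "x \<in> fst F" for x
    proof -
      have "(fst (f x), 0) \<in> f ` fst F" using that im B0 by (metis imageI mem_Times_iff fst_conv snd_conv)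
      then obtain y where "y \<in> fst F" "f y = (fst (f x), 0)" by auto
      then show ?thesis by (intro bexI[of _ y]) simp_all
    qed
    show "\<exists>y\<in>snd F i. fst (f y) = fst (f x) \<and> snd (f y) = 0" if "i \<in> {1..m}" "x \<in> snd F i" for i x
    proof -
      have "(fst (f x), 0) \<in> f ` snd F i"
        using that lines[OF that(1)] B0 by (metis imageI mem_Times_iff fst_conv snd_conv)
      then obtain y where "y \<in> snd F i" "f y = (fst (f x), 0)" by auto
      then show ?thesis by (intro bexI[of _ y]) simp_all
    qed
  qed
  then show False
  proof
    assume z: "\<forall>x\<in>fst F. fst (f x) = 0"
    obtain a where a: "a \<in> fst A" "a \<noteq> 0" using nontrivial A by blast
    then have "(a, 0) \<in> f ` fst F" using im B0 by blast
    then show False using z a by (metis imageE fst_conv)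
  next
    assume z: "\<forall>x\<in>fst F. snd (f x) = 0"
    obtain b where b: "b \<in> fst B" "b \<noteq> 0" using nontrivial B by blast
    then have "(0, b) \<in> f ` fst F" using im A0 by blast
    then show False using z b by (metis imageE snd_conv)
  qed
qed

text \<open>The vector y is a multiple k x. If k = 0, then \<phi> x = 0; otherwise \<psi> x = 0. So
  a line lies in one of the two summands.\<close>

lemma hom_on_split_line:
  assumes "hom_on V \<phi>" "hom_on V \<psi>" "x \<in> V"
    and "\<exists>y\<in>span {x}. \<phi> y = \<phi> x \<and> \<psi> y = 0"
  shows "\<phi> x = 0 \<or> \<psi> x = 0"
proof -
  obtain k where "\<phi> (scale k x) = \<phi> x" "\<psi> (scale k x) = 0"
    using assms(4) by (auto simp: span_singleton)
  then show ?thesis using assms(1-3) by (auto simp: hom_on_def)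
qed

text \<open>Covers the one-dimensional summands that carry no marked line: the splitting argument is
  applied to the whole space, which is itself a line.\<close>

lemma indecomposable_line:
  assumes "fst F = span {b}"
  shows "indecomposable_mflag scale m F"
proof (rule indecomposableI)
  fix \<phi> \<psi> assume h: "hom_on (fst F) \<phi>" "hom_on (fst F) \<psi>"
    and ex: "\<And>x. x \<in> fst F \<Longrightarrow> \<exists>y\<in>fst F. \<phi> y = \<phi> x \<and> \<psi> y = 0"
  have "b \<in> fst F" using assms by (simp add: span_base)
  then have "\<phi> b = 0 \<or> \<psi> b = 0" using h ex assms by (intro hom_on_split_line) auto
  then show "(\<forall>x\<in>fst F. \<phi> x = 0) \<or> (\<forall>x\<in>fst F. \<psi> x = 0)"
    using h \<open>b \<in> fst F\<close> hom_on_span_eq_0[of "fst F" _ "{()}" "\<lambda>_. b"] assms by auto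
qed (use assms in simp)

lemma connected_imp_indecomposable:
  assumes "fst F = span (w ` S)" "finite S" "S \<subseteq> {1..m}" "\<And>i. i \<in> S \<Longrightarrow> snd F i = span {w i}"
    and "connected_family w S"
  shows "indecomposable_mflag scale m F"
proof (rule indecomposableI)
  show sub: "subspace (fst F)" using assms(1) by simp
  fix \<phi> \<psi> assume h: "hom_on (fst F) \<phi>" "hom_on (fst F) \<psi>"
    and inj: "\<And>x. x \<in> fst F \<Longrightarrow> \<phi> x = 0 \<Longrightarrow> \<psi> x = 0 \<Longrightarrow> x = 0"
    and ex: "\<And>i x. i \<in> {1..m} \<Longrightarrow> x \<in> snd F i \<Longrightarrow> \<exists>y\<in>snd F i. \<phi> y = \<phi> x \<and> \<psi> y = 0"
  have w: "w i \<in> fst F" if "i \<in> S" for i using that assms(1) by (simp add: span_base)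
  have split: "\<phi> (w i) = 0 \<or> \<psi> (w i) = 0" if "i \<in> S" for i
    using h w[OF that] ex[of i "w i"] that assms(3,4)
    by (intro hom_on_split_line) (auto simp: span_base)
  \<comment> \<open>The indices whose lines lie in the first summand form a separator: the part over
    \<open>?T\<close> of a relation is killed by \<psi> termwise, and by \<phi> because \<phi> kills
    all remaining terms of the relation.\<close>
  let ?T = "{i \<in> S. \<psi> (w i) = 0}"
  have "separator w S ?T"
    unfolding separator_def
  proof (intro conjI allI impI)
    fix c assume c: "(\<Sum>i\<in>S. scale (c i) (w i)) = 0"
    let ?y = "\<Sum>i\<in>?T. scale (c i) (w i)"
    have phi0: "\<phi> 0 = 0" using hom_on_sum[OF sub h(1), of "{}"] by simp
    have "\<phi> ?y = (\<Sum>i\<in>?T. scale (c i) (\<phi> (w i)))"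
      using w by (intro hom_on_sum[OF sub h(1)]) auto
    also have "\<dots> = (\<Sum>i\<in>S. scale (c i) (\<phi> (w i)))"
      using assms(2) split by (intro sum.mono_neutral_left) auto
    also have "\<dots> = \<phi> 0" using hom_on_sum[OF sub h(1), of S w c] w c by simp
    finally have "\<phi> ?y = 0" using phi0 by simp
    moreover have "\<psi> ?y = 0" using hom_on_sum[OF sub h(2), of ?T w c] w by simp
    moreover have "?y \<in> fst F" using w by (intro subspace_sum[OF sub] subspace_scale[OF sub]) auto
    ultimately show "?y = 0" using inj by blast
  qed auto
  then have "?T = {} \<or> ?T = S" using assms(5) unfolding connected_family_def by blast
  then show "(\<forall>x\<in>fst F. \<phi> x = 0) \<or> (\<forall>x\<in>fst F. \<psi> x = 0)"
  proof
    assume "?T = {}"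
    then have "\<And>i. i \<in> S \<Longrightarrow> \<phi> (w i) = 0" using split by blast
    then show ?thesis using hom_on_span_eq_0[OF sub h(1) assms(2), of w] w assms(1) by blast
  next
    assume "?T = S"
    then have "\<And>i. i \<in> S \<Longrightarrow> \<psi> (w i) = 0" by blast
    then show ?thesis using hom_on_span_eq_0[OF sub h(2) assms(2), of w] w assms(1) by blast
  qed
qed

text \<open>The span of the vectors over T and a complement holding all other lines split F, and the
  first summand is non-trivial, so the complement is zero. With T = S this says that the vectors
  span; with arbitrary T it says that they are connected.\<close>

lemma indecomposable_separator:
  assumes F: "is_mflag scale m F" "indecomposable_mflag scale m F"
    and S: "S \<subseteq> {1..m}" "\<And>i. i \<in> S \<Longrightarrow> snd F i = span {w i} \<and> w i \<noteq> 0"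
      "\<And>i. i \<in> {1..m} - S \<Longrightarrow> snd F i = {0}"
    and T: "separator w S T" "T \<noteq> {}"
  shows "T = S \<and> fst F = span (w ` S)"
proof -
  have fin: "finite S" using S(1) finite_subset by blast
  have TS: "T \<subseteq> S" using T(1) by (rule separator_subset)
  have V: "subspace (fst F)" "\<And>i. i \<in> {1..m} \<Longrightarrow> subspace (snd F i) \<and> snd F i \<subseteq> fst F"
    using F(1) by (auto simp: is_mflag_iff)
  have w: "w i \<in> fst F" if "i \<in> S" for i
  proof -
    have "w i \<in> snd F i" using S(2)[OF that] by (simp add: span_base)
    then show ?thesis using V(2) that S(1) by blast
  qed
  let ?A = "span (w ` T)"
  have A: "?A \<subseteq> fst F" using w TS V(1) by (intro span_minimal) auto
  have W: "span (w ` (S - T)) \<subseteq> fst F" using w V(1) by (intro span_minimal) auto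
  have AW: "?A \<inter> span (w ` (S - T)) = {0}"
    using separator_span_Int[OF fin T(1), of "S - T"] by (auto simp: span_zero)
  obtain B where B: "subspace B" "span (w ` (S - T)) \<subseteq> B" "B \<subseteq> fst F" "?A \<inter> B = {0}"
    and sum: "\<forall>x\<in>fst F. \<exists>a\<in>?A. \<exists>b\<in>B. x = a + b"
    by (rule complement_exists[OF subspace_span V(1) subspace_span W A AW])
  \<comment> \<open>Every index outside T is assigned to \<open>GB\<close>, including those outside
    S, whose subspace is zero.\<close>
  define GA where "GA = (?A, \<lambda>i. if i \<in> T then snd F i else {0})"
  define GB where "GB = (B, \<lambda>i. if i \<in> T then {0} else snd F i)"
  have lineA: "snd F i \<subseteq> ?A" if "i \<in> T" for i
    using S(2)[of i] that TS span_mono[of "{w i}" "w ` T"] by auto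
  have lineB: "snd F i \<subseteq> B" if "i \<in> {1..m}" "i \<notin> T" for i
  proof (cases "i \<in> S")
    case True
    then have "span {w i} \<subseteq> span (w ` (S - T))" using that by (intro span_mono) auto
    then show ?thesis using S(2)[OF True] B(2) by blast
  next
    case False
    then show ?thesis using S(3) that subspace_0[OF B(1)] by simp
  qed
  have "is_mflag scale m GA" "is_mflag scale m GB"
    using V lineA lineB B(1) by (auto simp: is_mflag_iff GA_def GB_def span_zero subspace_0)
  moreover have "mflag_iso scale (scale_prod scale) m F (mflag_sum GA GB)"
  proof (rule mflag_isoI[where g = "\<lambda>(a, b). a + b"])
    have "inj_on (\<lambda>(a, b). a + b) (?A \<times> B)"
    proof (rule inj_onI, clarsimp)
      fix a b a' b' assume h: "a \<in> ?A" "b \<in> B" "a' \<in> ?A" "b' \<in> B" "a + b = a' + b'"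
      then have e: "a - a' = b' - b" by (simp add: algebra_simps)
      have "a - a' \<in> ?A" by (rule span_diff[OF h(1,3)])
      moreover have "b' - b \<in> B" by (rule subspace_diff[OF B(1) h(4,2)])
      ultimately have "a - a' \<in> ?A \<inter> B" using e by simp
      then have "a - a' = 0" unfolding B(4) by simp
      then show "a = a' \<and> b = b'" using e by simp
    qed
    moreover have "(\<lambda>(a, b). a + b) ` (?A \<times> B) = fst F"
    proof
      show "(\<lambda>(a, b). a + b) ` (?A \<times> B) \<subseteq> fst F"
        using A B(3) subspace_add[OF V(1)] by auto
      show "fst F \<subseteq> (\<lambda>(a, b). a + b) ` (?A \<times> B)" using sum by force
    qed
    ultimately show "bij_betw (\<lambda>(a, b). a + b) (fst (mflag_sum GA GB)) (fst F)"
      by (simp add: bij_betw_def mflag_sum_def GA_def GB_def)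
    show "snd (mflag_sum GA GB) i \<subseteq> fst (mflag_sum GA GB) \<and>
        (\<lambda>(a, b). a + b) ` snd (mflag_sum GA GB) i = snd F i" if i: "i \<in> {1..m}" for i
      using lineA[of i] lineB[of i] i span_zero[of "w ` T"] subspace_0[OF B(1)]
      by (force simp: mflag_sum_def GA_def GB_def)
  qed (use B(1) in \<open>auto simp: mflag_sum_def GA_def GB_def scale_prod_def algebra_simps
        scale_right_distrib intro: span_add span_scale subspace_add subspace_scale\<close>)
  ultimately have "trivial_mflag scale m GA \<or> trivial_mflag scale m GB"
    using F(2) unfolding indecomposable_mflag_def by blast
  moreover have "\<not> trivial_mflag scale m GA"
  proof -
    obtain i where "i \<in> T" using T(2) by blast
    then have "w i \<in> ?A" "w i \<noteq> 0" using S(2) TS by (auto intro: span_base)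
    then have "dim ?A \<noteq> 0" by (metis dim_eq_0 singletonD subsetD)
    then show ?thesis by (simp add: has_mdim_def GA_def)
  qed
  ultimately have "trivial_mflag scale m GB" by blast
  then have "dim B = 0" by (simp add: has_mdim_def GB_def)
  then have B0: "B \<subseteq> {0}" by simp
  have "S - T = {}"
  proof (rule ccontr)
    assume "S - T \<noteq> {}"
    then obtain i where i: "i \<in> S - T" by blast
    then have "w i \<in> span (w ` (S - T))" by (intro span_base) auto
    then show False using B0 B(2) S(2)[of i] i by auto
  qed
  then have "T = S" using TS by blast
  moreover have "fst F = ?A"
  proof
    show "fst F \<subseteq> ?A" using sum B0 by force
  qed (rule A)
  ultimately show ?thesis by simp
qed

text \<open>Criterion for an internal direct sum: independence and spanning of the subspaces, and
  each marked subspace lying entirely in one summand and being zero in the others.\<close>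

lemma mflag_iso_Sum:
  assumes I: "finite I" and X: "\<And>j. j \<in> I \<Longrightarrow> is_mflag scale m (X j) \<and> fst (X j) \<subseteq> fst F"
    and V: "subspace (fst F)"
    and inj: "\<And>x. (\<And>j. j \<in> I \<Longrightarrow> x j \<in> fst (X j)) \<Longrightarrow> (\<Sum>j\<in>I. x j) = 0 \<Longrightarrow> (\<forall>j\<in>I. x j = 0)"
    and surj: "\<And>y. y \<in> fst F \<Longrightarrow> \<exists>x. (\<forall>j\<in>I. x j \<in> fst (X j)) \<and> y = (\<Sum>j\<in>I. x j)"
    and lines: "\<And>i. i \<in> {1..m} \<Longrightarrow>
      \<exists>k\<in>I. snd (X k) i = snd F i \<and> (\<forall>j\<in>I - {k}. snd (X j) i = {0})"
  shows "mflag_iso scale (scale_fun scale) m F (mflag_Sum I X)"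
proof (rule mflag_isoI[where g = "\<lambda>x. \<Sum>j\<in>I. x j"])
  have sub: "\<And>j. j \<in> I \<Longrightarrow> subspace (fst (X j))" using X by (simp add: is_mflag_iff)
  show "bij_betw (\<lambda>x. \<Sum>j\<in>I. x j) (fst (mflag_Sum I X)) (fst F)"
    unfolding bij_betw_def
  proof
    show "inj_on (\<lambda>x. \<Sum>j\<in>I. x j) (fst (mflag_Sum I X))"
    proof (rule inj_onI)
      fix x y assume xy: "x \<in> fst (mflag_Sum I X)" "y \<in> fst (mflag_Sum I X)"
        "(\<Sum>j\<in>I. x j) = (\<Sum>j\<in>I. y j)"
      have "\<forall>j\<in>I. x j - y j = 0"
        using xy sub by (intro inj) (auto simp: mflag_Sum_def sum_subtractf intro: subspace_diff)
      then show "x = y" using xy by (intro ext) (force simp: mflag_Sum_def)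
    qed
    show "(\<lambda>x. \<Sum>j\<in>I. x j) ` fst (mflag_Sum I X) = fst F"
    proof
      show "(\<lambda>x. \<Sum>j\<in>I. x j) ` fst (mflag_Sum I X) \<subseteq> fst F"
        using X V by (auto simp: mflag_Sum_def intro!: subspace_sum)
      show "fst F \<subseteq> (\<lambda>x. \<Sum>j\<in>I. x j) ` fst (mflag_Sum I X)"
      proof
        fix y assume "y \<in> fst F"
        then obtain x where x: "\<forall>j\<in>I. x j \<in> fst (X j)" "y = (\<Sum>j\<in>I. x j)" using surj by blast
        \<comment> \<open>The family is cut off outside I, since vectors of \<open>mflag_Sum\<close>
          vanish there.\<close>
        then have "y = (\<Sum>j\<in>I. if j \<in> I then x j else 0)" by simp
        then show "y \<in> (\<lambda>x. \<Sum>j\<in>I. x j) ` fst (mflag_Sum I X)"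
          using x(1) by (intro image_eqI[where x = "\<lambda>j. if j \<in> I then x j else 0"])
            (auto simp: mflag_Sum_def)
      qed
    qed
  qed
  show "x + y \<in> fst (mflag_Sum I X) \<and> (\<Sum>j\<in>I. (x + y) j) = (\<Sum>j\<in>I. x j) + (\<Sum>j\<in>I. y j)"
    if "x \<in> fst (mflag_Sum I X)" "y \<in> fst (mflag_Sum I X)" for x y
    using that sub by (auto simp: mflag_Sum_def sum.distrib intro: subspace_add)
  show "scale_fun scale c x \<in> fst (mflag_Sum I X) \<and>
      (\<Sum>j\<in>I. scale_fun scale c x j) = scale c (\<Sum>j\<in>I. x j)"
    if "x \<in> fst (mflag_Sum I X)" for c x
    using that sub by (auto simp: mflag_Sum_def scale_fun_def scale_sum_right intro: subspace_scale)
  show "snd (mflag_Sum I X) i \<subseteq> fst (mflag_Sum I X) \<and>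
      (\<lambda>x. \<Sum>j\<in>I. x j) ` snd (mflag_Sum I X) i = snd F i" if i: "i \<in> {1..m}" for i
  proof
    show "snd (mflag_Sum I X) i \<subseteq> fst (mflag_Sum I X)"
      using X i by (force simp: mflag_Sum_def is_mflag_iff)
    from lines[OF i] obtain k where k: "k \<in> I" "snd (X k) i = snd F i" "\<forall>j\<in>I - {k}. snd (X j) i = {0}"
      by (elim bexE conjE) (rule that)
    show "(\<lambda>x. \<Sum>j\<in>I. x j) ` snd (mflag_Sum I X) i = snd F i"
    proof
      have "(\<Sum>j\<in>I. x j) = x k" if "x \<in> snd (mflag_Sum I X) i" for x
      proof -
        have "(\<Sum>j\<in>I. x j) = (\<Sum>j\<in>{k}. x j)"
          using that k I by (intro sum.mono_neutral_right) (auto simp: mflag_Sum_def)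
        then show ?thesis by simp
      qed
      then show "(\<lambda>x. \<Sum>j\<in>I. x j) ` snd (mflag_Sum I X) i \<subseteq> snd F i"
        using k by (auto simp: mflag_Sum_def)
      show "snd F i \<subseteq> (\<lambda>x. \<Sum>j\<in>I. x j) ` snd (mflag_Sum I X) i"
      proof
        fix y assume "y \<in> snd F i"
        then show "y \<in> (\<lambda>x. \<Sum>j\<in>I. x j) ` snd (mflag_Sum I X) i"
          using k I by (intro image_eqI[where x = "\<lambda>j. if j = k then y else 0"])
            (auto simp: mflag_Sum_def)
      qed
    qed
  qed
qed

end

section \<open>Constructible flags\<close>

text \<open>Merging the three families into one index set lets most arguments treat all blocks
  alike: of the types only the set \<open>blocks j\<close> and the rank \<open>block_rank j\<close>
  remain.\<close>

fun block_index :: "ptuple \<Rightarrow> (nat set + nat set + nat set \<times> nat) set" where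
  "block_index (Is, Js, Ks) = Is <+> (Js <+> Ks)"

definition block_rank :: "nat set + nat set + nat set \<times> nat \<Rightarrow> nat" where
  "block_rank = case_sum (\<lambda>_. 1) (case_sum (\<lambda>J. card J - 1) snd)"

lemma rk_eq_sum_block_rank:
  assumes "finite (block_index p)"
  shows "rk p = (\<Sum>j\<in>block_index p. block_rank j)"
proof -
  obtain Is Js Ks where p: "p = (Is, Js, Ks)" by (cases p)
  have "finite Is" "finite Js" "finite Ks" using assms unfolding p by (simp_all add: finite_Plus_iff)
  then show ?thesis unfolding p by (simp add: sum.Plus block_rank_def case_prod_beta)
qed

text \<open>For most later arguments the three types matter only through the rank bound in
  \<open>PP_block\<close>. Finiteness holds because non-empty disjoint blocks are distinct subsets
  of {1..m}; it is what gives the \<open>card\<close> and the sums in \<open>rk\<close> their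
  intended values.\<close>

lemma
  assumes "p \<in> PP n m"
  shows PP_disjoint: "disjoint_family_on blocks (block_index p)"
    and PP_UN: "(\<Union>j\<in>block_index p. blocks j) = {1..m}"
    and PP_rk_le: "rk p \<le> n"
    and PP_block: "\<And>j. j \<in> block_index p \<Longrightarrow> blocks j \<noteq> {} \<and> 1 \<le> block_rank j \<and>
      (block_rank j = 1 \<or> block_rank j + 1 \<le> card (blocks j))"
    and PP_finite: "finite (block_index p)"
    and PP_rk: "rk p = (\<Sum>j\<in>block_index p. block_rank j)"
proof -
  obtain Is Js Ks where p: "p = (Is, Js, Ks)" by (cases p)
  show disj: "disjoint_family_on blocks (block_index p)"
    and UN: "(\<Union>j\<in>block_index p. blocks j) = {1..m}"
    and "rk p \<le> n"
    using assms unfolding PP_def p by (simp_all del: rk.simps)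
  have bounds: "\<And>I. I \<in> Is \<Longrightarrow> 1 \<le> card I" "\<And>J. J \<in> Js \<Longrightarrow> 3 \<le> card J"
    "\<And>K r. (K, r) \<in> Ks \<Longrightarrow> 4 \<le> r + 2 \<and> r + 2 \<le> card K"
    using assms unfolding PP_def p by auto
  show block: "blocks j \<noteq> {} \<and> 1 \<le> block_rank j \<and> (block_rank j = 1 \<or> block_rank j + 1 \<le> card (blocks j))"
    if "j \<in> block_index p" for j
    using that unfolding p
    by (auto simp: blocks_def block_rank_def split: sum.splits dest!: bounds)
  have inj: "inj_on blocks (block_index p)"
  proof (rule inj_onI)
    fix j k assume jk: "j \<in> block_index p" "k \<in> block_index p" "blocks j = blocks k"
    then have "blocks j \<inter> blocks k \<noteq> {}" using block by blast
    then show "j = k" using disj jk unfolding disjoint_family_on_def by blast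
  qed
  have "blocks ` block_index p \<subseteq> Pow {1..m}" using UN by blast
  then show fin: "finite (block_index p)"
    using inj finite_imageD finite_subset by (metis finite_Pow_iff finite_atLeastAtMost)
  then show "rk p = (\<Sum>j\<in>block_index p. block_rank j)" by (rule rk_eq_sum_block_rank)
qed

lemma constructible_iff:
  "constructible s n m p F \<longleftrightarrow> (\<exists>X.
     (\<forall>k\<in>{1..n - rk p}. X (Inl k) \<in> indec_of_dim s m (dvec {} 1)) \<and>
     (\<forall>j\<in>block_index p. X (Inr j) \<in> indec_of_dim s m (dvec (blocks j) (block_rank j))) \<and>
     mflag_iso s (scale_fun s) m F (mflag_Sum ({1..n - rk p} <+> block_index p) X))"
proof -
  obtain Is Js Ks where p: "p = (Is, Js, Ks)" by (cases p)
  show ?thesis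
  proof
    assume "constructible s n m p F"
    then obtain F0 F1 D E where
      "\<forall>k\<in>{1..n - rk (Is, Js, Ks)}. F0 k \<in> indec_of_dim s m (dvec {} 1)"
      "\<forall>I\<in>Is. F1 I \<in> indec_of_dim s m (dvec I 1)"
      "\<forall>J\<in>Js. D J \<in> indec_of_dim s m (dvec J (card J - 1))"
      "\<forall>(K, r)\<in>Ks. E (K, r) \<in> indec_of_dim s m (dvec K r)"
      "mflag_iso s (scale_fun s) m F
         (mflag_Sum ({1..n - rk (Is, Js, Ks)} <+> (Is <+> (Js <+> Ks)))
           (case_sum F0 (case_sum F1 (case_sum D E))))"
      unfolding p constructible.simps by (elim exE conjE) (rule that)
    then show "\<exists>X.
     (\<forall>k\<in>{1..n - rk p}. X (Inl k) \<in> indec_of_dim s m (dvec {} 1)) \<and>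
     (\<forall>j\<in>block_index p. X (Inr j) \<in> indec_of_dim s m (dvec (blocks j) (block_rank j))) \<and>
     mflag_iso s (scale_fun s) m F (mflag_Sum ({1..n - rk p} <+> block_index p) X)"
      by (intro exI[of _ "case_sum F0 (case_sum F1 (case_sum D E))"])
        (auto simp: p blocks_def block_rank_def simp del: rk.simps)
  next
    assume "\<exists>X.
     (\<forall>k\<in>{1..n - rk p}. X (Inl k) \<in> indec_of_dim s m (dvec {} 1)) \<and>
     (\<forall>j\<in>block_index p. X (Inr j) \<in> indec_of_dim s m (dvec (blocks j) (block_rank j))) \<and>
     mflag_iso s (scale_fun s) m F (mflag_Sum ({1..n - rk p} <+> block_index p) X)"
    then obtain X where X: "\<forall>k\<in>{1..n - rk p}. X (Inl k) \<in> indec_of_dim s m (dvec {} 1)"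
     "\<forall>j\<in>block_index p. X (Inr j) \<in> indec_of_dim s m (dvec (blocks j) (block_rank j))"
     "mflag_iso s (scale_fun s) m F (mflag_Sum ({1..n - rk p} <+> block_index p) X)"
      by (elim exE conjE) (rule that)
    have "case_sum (\<lambda>k. X (Inl k)) (case_sum (\<lambda>I. X (Inr (Inl I)))
        (case_sum (\<lambda>J. X (Inr (Inr (Inl J)))) (\<lambda>K. X (Inr (Inr (Inr K)))))) = X"
      by (auto split: sum.splits intro!: ext)
    moreover have "X (Inr (Inl I)) \<in> indec_of_dim s m (dvec I 1)" if "I \<in> Is" for I
      using X(2)[rule_format, of "Inl I"] that by (simp add: p blocks_def block_rank_def InlI InrI)
    moreover have "X (Inr (Inr (Inl J))) \<in> indec_of_dim s m (dvec J (card J - 1))" if "J \<in> Js" for J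
      using X(2)[rule_format, of "Inr (Inl J)"] that by (simp add: p blocks_def block_rank_def InlI InrI)
    moreover have "X (Inr (Inr (Inr (K, r)))) \<in> indec_of_dim s m (dvec K r)" if "(K, r) \<in> Ks" for K r
      using X(2)[rule_format, of "Inr (Inr (K, r))"] that by (simp add: p blocks_def block_rank_def InlI InrI)
    ultimately show "constructible s n m p F"
      unfolding p constructible.simps
      using X(1,3)[unfolded p block_index.simps]
      by - (rule exI[of _ "\<lambda>k. X (Inl k)"], rule exI[of _ "\<lambda>I. X (Inr (Inl I))"],
          rule exI[of _ "\<lambda>J. X (Inr (Inr (Inl J)))"], rule exI[of _ "\<lambda>K. X (Inr (Inr (Inr K)))"],
          auto simp del: rk.simps)
  qed
qed

section \<open>Decompositions of a flag and partitions of its index set\<close>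

context flag_space
begin

text \<open>The lines spanned by v decompose into the blocks of p, with the prescribed ranks.\<close>

definition fits :: "(nat \<Rightarrow> 'b) \<Rightarrow> nat \<Rightarrow> ptuple \<Rightarrow> bool" where
  "fits v m p \<longleftrightarrow> (\<forall>j\<in>block_index p. separator v {1..m} (blocks j) \<and>
     connected_family v (blocks j) \<and> dim (v ` blocks j) = block_rank j)"

lemma line_eq_span:
  assumes "subspace L" "dim L = 1" "x \<in> L" "x \<noteq> 0"
  shows "L = span {x}"
proof (rule subspace_dim_equal[symmetric])
  show "span {x} \<subseteq> L" using assms by (intro span_minimal) auto
  show "dim L \<le> dim (span {x})" using assms(2,4) by simp
qed (use assms in auto)

text \<open>The prescribed dimensions make the i-th subspace zero in every summand except that of
  the block containing i, so the image of v i has a single non-zero coordinate. Relations within a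
  block can therefore be read in its summand, where indecomposability gives connectedness and
  rank.\<close>

lemma constructible_imp_fits:
  assumes p: "p \<in> PP n m" and con: "constructible scale n m p F" and F: "is_mflag scale m F"
    and lines: "\<And>i. i \<in> {1..m} \<Longrightarrow> snd F i = span {v i} \<and> v i \<noteq> 0"
  shows "fits v m p"
proof -
  let ?I = "{1..n - rk p} <+> block_index p"
  obtain X where X0: "\<forall>k\<in>{1..n - rk p}. X (Inl k) \<in> indec_of_dim scale m (dvec {} 1)"
    and X1: "\<forall>j\<in>block_index p. X (Inr j) \<in> indec_of_dim scale m (dvec (blocks j) (block_rank j))"
    and iso: "mflag_iso scale (scale_fun scale) m F (mflag_Sum ?I X)"
    using con unfolding constructible_iff by (elim exE conjE) (rule that)
  obtain f where bij: "bij_betw f (fst F) (fst (mflag_Sum ?I X))"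
    and add: "\<forall>x\<in>fst F. \<forall>y\<in>fst F. f (x + y) = f x + f y"
    and sc: "\<forall>c. \<forall>x\<in>fst F. f (scale c x) = scale_fun scale c (f x)"
    and img: "\<forall>i\<in>{1..m}. f ` snd F i = snd (mflag_Sum ?I X) i"
    using iso unfolding mflag_iso_def by (elim exE conjE) (rule that)
  have sub: "subspace (fst F)" using F by (simp add: is_mflag_iff)
  have hom: "hom_on (fst F) (\<lambda>x. f x j)" for j
    using add sc by (simp add: hom_on_def scale_fun_def)
  \<comment> \<open>The component in summand j of the image of the i-th vector.\<close>
  define w where "w j i = f (v i) j" for j i
  have v: "v i \<in> fst F" if "i \<in> {1..m}" for i
  proof -
    have "v i \<in> snd F i" using lines[OF that] span_base[of "v i" "{v i}"] by simp
    then show ?thesis using F that unfolding is_mflag_iff by blast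
  qed
  have f_sum: "f (\<Sum>i\<in>T. scale (c i) (v i)) j = (\<Sum>i\<in>T. scale (c i) (w j i))" if "T \<subseteq> {1..m}" for T c j
    unfolding w_def using that v by (intro hom_on_sum[OF sub hom]) auto
  have f_zero: "x = 0" if "x \<in> fst F" "\<And>j. f x j = 0" for x
  proof -
    have "f 0 = f x" using f_sum[of "{}"] that(2) by auto
    then show ?thesis
      using bij that(1) subspace_0[OF sub] by (auto simp: bij_betw_def dest: inj_onD)
  qed
  have mem: "f (v i) \<in> snd (mflag_Sum ?I X) i" if "i \<in> {1..m}" for i
    using img[rule_format, OF that] lines[OF that] span_base[of "v i" "{v i}"] by auto
  then have w_mem: "w j i \<in> snd (X j) i" if "i \<in> {1..m}" "j \<in> ?I" for i j
    using that by (auto simp: mflag_Sum_def w_def)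
  have block_sub: "blocks j \<subseteq> {1..m}" if "j \<in> block_index p" for j
    using PP_UN[OF p] that by blast
  have zero: "snd (X (Inr j)) i = {0}" if "j \<in> block_index p" "i \<in> {1..m} - blocks j" for i j
  proof -
    have "dim (snd (X (Inr j)) i) = 0" "subspace (snd (X (Inr j)) i)"
      using X1[rule_format, OF that(1)] that(2)
      by (auto simp: indec_of_dim_def has_mdim_def dvec_def is_mflag_iff)
    then show ?thesis using subspace_0 by auto
  qed
  have w_zero: "w k i = 0" if "j \<in> block_index p" "i \<in> blocks j" "k \<noteq> Inr j" for i j k
  proof -
    have i: "i \<in> {1..m}" using that block_sub by blast
    show ?thesis
    proof (cases "k \<in> ?I")
      case False
      then show ?thesis using mem[OF i] by (auto simp: mflag_Sum_def w_def)
    next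
      case True
      then show ?thesis
      proof (cases k)
        case (Inl l)
        then have "l \<in> {1..n - rk p}" using True by auto
        then have "dim (snd (X k) i) = 0"
          using X0[rule_format, of l] Inl i
            by (simp add: indec_of_dim_def has_mdim_def dvec_def del: dim_eq_0)
        then show ?thesis using w_mem[OF i True] by auto
      next
        case (Inr l)
        then have l: "l \<in> block_index p" "l \<noteq> j" using True that by auto
        then have "i \<notin> blocks l"
          using PP_disjoint[OF p] that unfolding disjoint_family_on_def by blast
        then show ?thesis using zero[OF l(1), of i] w_mem[OF i True] i Inr by simp
      qed
    qed
  qed
  have w_nonzero: "w (Inr j) i \<noteq> 0" if "j \<in> block_index p" "i \<in> blocks j" for i j
  proof
    assume 0: "w (Inr j) i = 0"
    have i: "i \<in> {1..m}" using that block_sub by blast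
    have "f (v i) k = 0" for k using 0 w_zero[OF that, of k] by (cases "k = Inr j") (auto simp: w_def)
    then show False using f_zero v[OF i] lines[OF i] by blast
  qed
  \<comment> \<open>Over a block, all coordinates other than j vanish termwise, so injectivity of f
    reduces a relation to coordinate j.\<close>
  have rel: "(\<Sum>i\<in>T. scale (c i) (v i)) = 0 \<longleftrightarrow> (\<Sum>i\<in>T. scale (c i) (w (Inr j) i)) = 0"
    if j: "j \<in> block_index p" "T \<subseteq> blocks j" for j T c
  proof
    have T: "T \<subseteq> {1..m}" using j block_sub by blast
    show "(\<Sum>i\<in>T. scale (c i) (w (Inr j) i)) = 0" if "(\<Sum>i\<in>T. scale (c i) (v i)) = 0"
      using f_sum[OF T, of c "Inr j"] f_sum[of "{}" c "Inr j"] that by simp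
    assume "(\<Sum>i\<in>T. scale (c i) (w (Inr j) i)) = 0"
    moreover have "(\<Sum>i\<in>T. scale (c i) (w k i)) = 0" if "k \<noteq> Inr j" for k
      using w_zero[OF j(1) _ that] j(2) by (intro sum.neutral) auto
    ultimately have "f (\<Sum>i\<in>T. scale (c i) (v i)) k = 0" for k
      unfolding f_sum[OF T] by (cases "k = Inr j") auto
    moreover have "(\<Sum>i\<in>T. scale (c i) (v i)) \<in> fst F"
      using T v by (intro subspace_sum[OF sub] subspace_scale[OF sub]) auto
    ultimately show "(\<Sum>i\<in>T. scale (c i) (v i)) = 0" by (rule f_zero[rotated])
  qed
  show ?thesis
    unfolding fits_def
  proof (intro ballI conjI)
    fix j assume j: "j \<in> block_index p"
    note S = block_sub[OF j]
    have fin: "finite (blocks j)" using S finite_subset by blast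
    have Xj: "is_mflag scale m (X (Inr j))" "indecomposable_mflag scale m (X (Inr j))"
      "dim (fst (X (Inr j))) = block_rank j"
      "\<And>i. i \<in> blocks j \<Longrightarrow> dim (snd (X (Inr j)) i) = 1"
      using X1[rule_format, OF j] S by (auto simp: indec_of_dim_def has_mdim_def dvec_def)
    have line: "snd (X (Inr j)) i = span {w (Inr j) i} \<and> w (Inr j) i \<noteq> 0" if i: "i \<in> blocks j" for i
    proof
      have im: "i \<in> {1..m}" using i S by blast
      show "w (Inr j) i \<noteq> 0" by (rule w_nonzero[OF j i])
      show "snd (X (Inr j)) i = span {w (Inr j) i}"
        using Xj(1) im j by (intro line_eq_span Xj(4)[OF i] w_mem[OF im] w_nonzero[OF j i])
          (auto simp: is_mflag_iff)
    qed
    have split: "T = blocks j \<and> fst (X (Inr j)) = span (w (Inr j) ` blocks j)"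
      if "separator (w (Inr j)) (blocks j) T" "T \<noteq> {}" for T
      by (rule indecomposable_separator[OF Xj(1,2) S _ _ that]) (rule line zero[OF j], assumption)+
    have "fst (X (Inr j)) = span (w (Inr j) ` blocks j)"
      using split[OF separator_refl] PP_block[OF p j] by blast
    then have "dim (w (Inr j) ` blocks j) = block_rank j" using Xj(3) by simp
    moreover have "dim (v ` blocks j) = dim (w (Inr j) ` blocks j)"
      using rel[OF j] by (intro antisym rank_mono_relations[OF fin]) blast+
    ultimately show "dim (v ` blocks j) = block_rank j" by simp
    show "connected_family v (blocks j)"
      unfolding connected_family_def
    proof (intro allI impI)
      fix T assume T: "separator v (blocks j) T"
      then have "T \<subseteq> blocks j" by (rule separator_subset)
      then have "separator (w (Inr j)) (blocks j) T"
        using T rel[OF j] by (simp add: separator_def)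
      then show "T = {} \<or> T = blocks j" using split by blast
    qed
    show "separator v {1..m} (blocks j)"
      unfolding separator_def
    proof (intro conjI allI impI)
      show "blocks j \<subseteq> {1..m}" by (rule S)
      fix c assume c: "(\<Sum>i\<in>{1..m}. scale (c i) (v i)) = 0"
      \<comment> \<open>Projecting the relation to summand j therefore discards every term outside
        the block.\<close>
      have "w (Inr j) i = 0" if i: "i \<in> {1..m} - blocks j" for i
        using w_mem[of i "Inr j"] zero[OF j i] i j by auto
      then have "(\<Sum>i\<in>blocks j. scale (c i) (w (Inr j) i)) = (\<Sum>i\<in>{1..m}. scale (c i) (w (Inr j) i))"
        using S by (intro sum.mono_neutral_left) auto
      also have "\<dots> = f 0 (Inr j)" using f_sum[of "{1..m}" c "Inr j"] c by simp
      also have "\<dots> = 0" using f_sum[of "{}" c "Inr j"] by simp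
      finally show "(\<Sum>i\<in>blocks j. scale (c i) (v i)) = 0" using rel[OF j subset_refl] by blast
    qed
  qed
qed

text \<open>The vector x j lies in the span over its own set and, as minus the sum of the others, in
  the span over the complement; these meet only in 0.\<close>

lemma separators_direct:
  assumes "finite M" "finite J" "\<And>j. j \<in> J \<Longrightarrow> separator v M (B j)" "disjoint_family_on B J"
    and "\<And>j. j \<in> J \<Longrightarrow> x j \<in> span (v ` B j)" "(\<Sum>j\<in>J. x j) = 0" "j \<in> J"
  shows "x j = 0"
proof (rule separator_span_Int[OF assms(1) assms(3)[OF assms(7)]])
  show "x j \<in> span (v ` B j)" using assms by simp
  have "x k \<in> span (v ` (M - B j))" if k: "k \<in> J - {j}" for k
  proof -
    have "B k \<subseteq> M - B j"
      using k assms(3)[of k] assms(4,7) separator_subset[of v M "B k"]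
      by (auto simp: disjoint_family_on_def)
    then show ?thesis using assms(5)[of k] k span_mono[of "v ` B k" "v ` (M - B j)"] by blast
  qed
  then have "- (\<Sum>k\<in>J - {j}. x k) \<in> span (v ` (M - B j))" by (intro span_neg span_sum)
  moreover have "x j = - (\<Sum>k\<in>J - {j}. x k)"
    using assms(6) sum.remove[OF assms(2,7), of x] by (simp add: eq_neg_iff_add_eq_0)
  ultimately show "x j \<in> span (v ` (M - B j))" by simp
qed auto

text \<open>The summands are the spans of the blocks and the lines through a basis of a complement
  of the span of all v i. Additivity of ranks makes \<open>rk p\<close> the dimension of that span,
  so the complement supplies exactly n - \<open>rk p\<close> lines.\<close>

lemma fits_imp_constructible:
  assumes p: "p \<in> PP n m" and fits: "fits v m p" and n: "n = dim (UNIV :: 'b set)"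
    and F: "fst F = UNIV" and lines: "\<And>i. i \<in> {1..m} \<Longrightarrow> snd F i = span {v i}"
  shows "constructible scale n m p F"
proof -
  let ?M = "{1..m}" and ?J = "block_index p"
  let ?q = "n - rk p"
  note fin = PP_finite[OF p]
  have sep: "separator v ?M (blocks j)" and con: "connected_family v (blocks j)"
    and rank: "dim (v ` blocks j) = block_rank j" if "j \<in> ?J" for j
    using fits that by (auto simp: fits_def)
  have block_sub: "blocks j \<subseteq> ?M" if "j \<in> ?J" for j
    using PP_UN[OF p] that by blast
  have block_fin: "finite (blocks j)" if "j \<in> ?J" for j
    using block_sub[OF that] finite_subset by blast
  have rk: "rk p = dim (v ` ?M)"
    using rank_separator_UN[of ?M ?J v blocks] sep fin PP_disjoint[OF p] PP_UN[OF p] PP_rk[OF p] rank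
    by simp
  let ?A = "span (v ` ?M)"
  obtain B where B: "subspace B" "{0} \<subseteq> B" "B \<subseteq> UNIV" "?A \<inter> B = {0}"
    and AB: "\<forall>x\<in>UNIV. \<exists>a\<in>?A. \<exists>b\<in>B. x = a + b"
    by (rule complement_exists[of ?A UNIV "{0}"]) (auto simp: span_zero)
  have "dim {x + y |x y. x \<in> ?A \<and> y \<in> B} + dim (?A \<inter> B) = dim ?A + dim B"
    using B(1) by (intro dim_sums_Int subspace_span)
  moreover have "{x + y |x y. x \<in> ?A \<and> y \<in> B} = UNIV" using AB by blast
  ultimately have dimB: "dim B = ?q" using B(4) rk n by simp
  obtain C where C: "C \<subseteq> B" "independent C" "B \<subseteq> span C" "card C = dim B"
    using basis_exists by metis
  have "finite C" using C(2) by (rule finiteI_independent)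
  then obtain b where b: "bij_betw b {1..?q} C"
    using ex_bij_betw_nat_finite_1 C(4) dimB by metis
  then have bC: "b ` {1..?q} = C" by (simp add: bij_betw_def)
  have spanC: "span C = B" using C B(1) by (metis span_subspace)
  have indep: "independent_family b {1..?q}"
    by (rule rank_eq_card_imp_independent_family)
      (simp_all only: bC dim_eq_card_independent[OF C(2)] C(4) dimB card_atLeastAtMost
        finite_atLeastAtMost diff_Suc_1)
  define X where "X = case_sum (\<lambda>k. (span {b k}, \<lambda>i. {0}))
    (\<lambda>j. (span (v ` blocks j), \<lambda>i. if i \<in> blocks j then snd F i else {0}))"
  have Xl: "X (Inl k) = (span {b k}, \<lambda>i. {0})"
    and Xr: "X (Inr j) = (span (v ` blocks j), \<lambda>i. if i \<in> blocks j then snd F i else {0})" for k j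
    by (simp_all add: X_def)
  have b0: "b k \<noteq> 0" if "k \<in> {1..?q}" for k
    using that C(2) dependent_zero bC by (metis imageI)
  have line_sub: "snd F i \<subseteq> span (v ` blocks j)" if "j \<in> ?J" "i \<in> blocks j" for i j
  proof -
    have "i \<in> ?M" using block_sub[OF that(1)] that(2) by blast
    then show ?thesis using lines[of i] that span_mono[of "{v i}" "v ` blocks j"] by simp
  qed
  have line_subspace: "subspace (snd F i)" if "i \<in> ?M" for i using lines[OF that] by simp
  have flag_r: "is_mflag scale m (X (Inr j))" if "j \<in> ?J" for j
    using line_subspace line_sub[OF that] by (simp add: is_mflag_iff Xr span_zero)
  have flag_l: "is_mflag scale m (X (Inl k))" for k
    by (auto simp: is_mflag_iff Xl span_zero)
  \<comment> \<open>The index of a zero vector separates by itself, so it would be a whole block, of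
    rank 0, while blocks have rank at least 1.\<close>
  have v0: "v i \<noteq> 0" if "j \<in> ?J" "i \<in> blocks j" for i j
  proof
    assume 0: "v i = 0"
    have "separator v (blocks j) {i}"
      using that(2) 0 by (auto simp: separator_def)
    then have "blocks j = {i}" using con[OF that(1)] by (auto simp: connected_family_def)
    then have "dim (v ` blocks j) = 0" using 0 by simp
    then show False using rank[OF that(1)] PP_block[OF p that(1)] by simp
  qed
  have "mflag_iso scale (scale_fun scale) m F (mflag_Sum ({1..?q} <+> ?J) X)"
  proof (rule mflag_iso_Sum)
    show "finite ({1..?q} <+> ?J)" using fin by simp
    show "is_mflag scale m (X j) \<and> fst (X j) \<subseteq> fst F" if "j \<in> {1..?q} <+> ?J" for j
      using that flag_l flag_r F by auto
    show "subspace (fst F)" by (simp add: F)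
    show "\<exists>k\<in>{1..?q} <+> ?J. snd (X k) i = snd F i \<and> (\<forall>j\<in>({1..?q} <+> ?J) - {k}. snd (X j) i = {0})"
      if "i \<in> ?M" for i
    proof -
      obtain j where j: "j \<in> ?J" "i \<in> blocks j" using PP_UN[OF p] \<open>i \<in> ?M\<close> by blast
      have "i \<notin> blocks l" if "l \<in> ?J" "l \<noteq> j" for l
        using PP_disjoint[OF p] j that unfolding disjoint_family_on_def by blast
      then show ?thesis using j by (intro bexI[of _ "Inr j"]) (auto simp: Xl Xr)
    qed
    show "\<exists>x. (\<forall>j\<in>{1..?q} <+> ?J. x j \<in> fst (X j)) \<and> y = (\<Sum>j\<in>{1..?q} <+> ?J. x j)" for y
    proof -
      obtain a b' where y: "a \<in> ?A" "b' \<in> B" "y = a + b'" using AB by blast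
      obtain c where c: "a = (\<Sum>i\<in>?M. scale (c i) (v i))"
        using y(1) span_image_finite[of ?M v] by auto
      have "b' \<in> span (b ` {1..?q})" using y(2) bC spanC by simp
      then obtain d where d: "b' = (\<Sum>k\<in>{1..?q}. scale (d k) (b k))"
        using span_image_finite[of "{1..?q}" b] by auto
      let ?x = "case_sum (\<lambda>k. scale (d k) (b k)) (\<lambda>j. \<Sum>i\<in>blocks j. scale (c i) (v i))"
      have "a = (\<Sum>j\<in>?J. \<Sum>i\<in>blocks j. scale (c i) (v i))"
        unfolding c PP_UN[OF p, symmetric] using fin block_fin PP_disjoint[OF p]
        by (intro sum.UNION_disjoint) (auto simp: disjoint_family_on_def)
      then have "y = (\<Sum>j\<in>{1..?q} <+> ?J. ?x j)"
        using fin by (simp add: sum.Plus y(3) d add.commute)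
      moreover have "?x j \<in> fst (X j)" if "j \<in> {1..?q} <+> ?J" for j
        using that
        by (elim PlusE) (simp_all add: Xl Xr span_base span_scale span_sum)
      ultimately show ?thesis by blast
    qed
    show "\<forall>j\<in>{1..?q} <+> ?J. x j = 0"
      if x: "\<And>j. j \<in> {1..?q} <+> ?J \<Longrightarrow> x j \<in> fst (X j)" and 0: "(\<Sum>j\<in>{1..?q} <+> ?J. x j) = 0" for x
    proof -
      have xl: "x (Inl k) \<in> span {b k}" if "k \<in> {1..?q}" for k using x[OF InlI[OF that]] by (simp add: Xl)
      have xr: "x (Inr j) \<in> span (v ` blocks j)" if "j \<in> ?J" for j using x[OF InrI[OF that]] by (simp add: Xr)
      have "(\<Sum>k\<in>{1..?q}. x (Inl k)) \<in> B"
      proof (rule subspace_sum[OF B(1)])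
        fix k assume k: "k \<in> {1..?q}"
        then have "span {b k} \<subseteq> span C" using bC by (intro span_mono) auto
        then show "x (Inl k) \<in> B" using xl[OF k] spanC by blast
      qed
      moreover have "(\<Sum>j\<in>?J. x (Inr j)) \<in> ?A"
      proof (rule span_sum)
        fix j assume j: "j \<in> ?J"
        then have "span (v ` blocks j) \<subseteq> ?A" using block_sub by (intro span_mono) auto
        then show "x (Inr j) \<in> ?A" using xr[OF j] by blast
      qed
      \<comment> \<open>The two partial sums are negatives of each other, one in B and one in
        \<open>?A\<close>, so both vanish; then each is treated separately.\<close>
      moreover have s: "(\<Sum>k\<in>{1..?q}. x (Inl k)) + (\<Sum>j\<in>?J. x (Inr j)) = 0"
        using 0 fin by (simp add: sum.Plus)
      ultimately have "(\<Sum>k\<in>{1..?q}. x (Inl k)) \<in> ?A \<inter> B"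
        using span_neg by (metis IntI eq_neg_iff_add_eq_0)
      then have sl: "(\<Sum>k\<in>{1..?q}. x (Inl k)) = 0" unfolding B(4) by simp
      then have sr: "(\<Sum>j\<in>?J. x (Inr j)) = 0" using s by simp
      have "\<forall>k\<in>{1..?q}. \<exists>d. x (Inl k) = scale d (b k)" using xl unfolding span_singleton by blast
      then obtain d where d: "\<forall>k\<in>{1..?q}. x (Inl k) = scale (d k) (b k)" by metis
      then have "(\<Sum>k\<in>{1..?q}. scale (d k) (b k)) = 0" using sl by simp
      then have "\<forall>k\<in>{1..?q}. d k = 0" using indep unfolding independent_family_def by blast
      then have "\<forall>k\<in>{1..?q}. x (Inl k) = 0" using d by simp
      moreover have "x (Inr j) = 0" if "j \<in> ?J" for j
        by (rule separators_direct[of ?M ?J v blocks "\<lambda>j. x (Inr j)"])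
          (use sep xr sr that fin PP_disjoint[OF p] in auto)
      ultimately show ?thesis by auto
    qed
  qed
  moreover have "X (Inl k) \<in> indec_of_dim scale m (dvec {} 1)" if "k \<in> {1..?q}" for k
    using flag_l indecomposable_line[of "X (Inl k)"] b0[OF that]
    by (auto simp: indec_of_dim_def has_mdim_def dvec_def Xl)
  moreover have "X (Inr j) \<in> indec_of_dim scale m (dvec (blocks j) (block_rank j))" if j: "j \<in> ?J" for j
  proof -
    have "indecomposable_mflag scale m (X (Inr j))"
      using block_fin[OF j] block_sub[OF j] con[OF j] lines
      by (intro connected_imp_indecomposable[where w = v and S = "blocks j"]) (auto simp: Xr)
    moreover have "has_mdim scale m (X (Inr j)) (dvec (blocks j) (block_rank j))"
      using rank[OF j] lines v0[OF j] by (auto simp: has_mdim_def dvec_def Xr)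
    ultimately show ?thesis using flag_r[OF j] by (simp add: indec_of_dim_def)
  qed
  ultimately show ?thesis unfolding constructible_iff by blast
qed

end

section \<open>The tuple of connected components: existence and uniqueness\<close>

context flag_space
begin

text \<open>These are the connected components of the matroid of v. The empty set must be excluded,
  as it is always a connected separator.\<close>

definition component :: "(nat \<Rightarrow> 'b) \<Rightarrow> nat \<Rightarrow> nat set \<Rightarrow> bool" where
  "component v m S \<longleftrightarrow> S \<noteq> {} \<and> separator v {1..m} S \<and> connected_family v S"

definition component_tuple :: "(nat \<Rightarrow> 'b) \<Rightarrow> nat \<Rightarrow> ptuple" where
  "component_tuple v m =
     ({S. component v m S \<and> dim (v ` S) = 1},
      {S. component v m S \<and> 2 \<le> dim (v ` S) \<and> dim (v ` S) + 1 = card S},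
      {(S, r). component v m S \<and> r = dim (v ` S) \<and> 2 \<le> r \<and> r + 2 \<le> card S})"

text \<open>The blocks cover {1..m}, so a component meets some block, and connected separators that
  meet are equal.\<close>

lemma component_iff_block:
  assumes p: "p \<in> PP n m" and fits: "fits v m p"
  shows "component v m S \<longleftrightarrow> (\<exists>j\<in>block_index p. S = blocks j)"
proof
  assume "\<exists>j\<in>block_index p. S = blocks j"
  then show "component v m S" using fits PP_block[OF p] by (auto simp: fits_def component_def)
next
  assume S: "component v m S"
  then obtain i where i: "i \<in> S" "i \<in> {1..m}"
    using separator_subset unfolding component_def by blast
  then obtain j where j: "j \<in> block_index p" "i \<in> blocks j" using PP_UN[OF p] by blast
  then have "S = blocks j \<or> S \<inter> blocks j = {}"
    using S fits by (intro connected_separators_disjoint[of "{1..m}" v]) (auto simp: component_def fits_def)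
  then show "\<exists>j\<in>block_index p. S = blocks j" using i j by blast
qed

text \<open>The conditions on rank and size for the three types exclude each other, so each
  component can occur only in the family that its rank dictates, and r is determined as
  well.\<close>

lemma fits_eq_component_tuple:
  assumes p: "p \<in> PP n m" and fits: "fits v m p"
  shows "p = component_tuple v m"
proof -
  obtain Is Js Ks where p': "p = (Is, Js, Ks)" by (cases p)
  have block: "component v m (blocks j) \<and> dim (v ` blocks j) = block_rank j" if "j \<in> Is <+> (Js <+> Ks)" for j
    using that component_iff_block[OF p fits] fits by (auto simp: fits_def p')
  have I: "component v m I \<and> dim (v ` I) = 1" if "I \<in> Is" for I
    using block[OF InlI[OF that]] by (simp add: blocks_def block_rank_def)
  have J: "component v m J \<and> 2 \<le> dim (v ` J) \<and> dim (v ` J) + 1 = card J" if "J \<in> Js" for J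
  proof -
    have "3 \<le> card J" using p that by (simp add: PP_def p' del: rk.simps)
    then show ?thesis using block[OF InrI[OF InlI[OF that]]] by (simp add: blocks_def block_rank_def)
  qed
  have K: "component v m K \<and> r = dim (v ` K) \<and> 2 \<le> r \<and> r + 2 \<le> card K" if "(K, r) \<in> Ks" for K r
  proof -
    have "4 \<le> r + 2 \<and> r + 2 \<le> card K" using p that by (auto simp: PP_def p' simp del: rk.simps)
    then show ?thesis using block[OF InrI[OF InrI[OF that]]] by (simp add: blocks_def block_rank_def)
  qed
  have cover: "S \<in> Is \<or> S \<in> Js \<or> (\<exists>r. (S, r) \<in> Ks)" if "component v m S" for S
    using that unfolding component_iff_block[OF p fits] p' by (auto simp: blocks_def)
  have "Is = {S. component v m S \<and> dim (v ` S) = 1}"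
    using I J K cover by (fastforce simp del: dim_eq_0)
  moreover have "Js = {S. component v m S \<and> 2 \<le> dim (v ` S) \<and> dim (v ` S) + 1 = card S}"
    using I J K cover by (fastforce simp del: dim_eq_0)
  moreover have "Ks = {(S, r). component v m S \<and> r = dim (v ` S) \<and> 2 \<le> r \<and> r + 2 \<le> card S}"
    using I J K cover by (fastforce simp del: dim_eq_0)
  ultimately show ?thesis unfolding p' component_tuple_def by simp
qed

lemma component_tuple_fits:
  assumes v: "\<And>i. i \<in> {1..m} \<Longrightarrow> v i \<noteq> 0" and n: "dim (v ` {1..m}) \<le> n"
  shows "component_tuple v m \<in> PP n m" and "fits v m (component_tuple v m)"
proof -
  let ?p = "component_tuple v m"
  have block: "component v m (blocks j) \<and> dim (v ` blocks j) = block_rank j" if "j \<in> block_index ?p" for j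
    using that by (auto simp: component_tuple_def blocks_def block_rank_def)
  then show fits: "fits v m ?p" by (simp add: fits_def component_def)
  \<comment> \<open>No set is listed twice, under two types or with two values of r. Disjointness of
    the indexed family needs this in addition to disjointness of distinct components.\<close>
  have inj: "inj_on blocks (block_index ?p)"
    by (rule inj_onI) (auto simp: component_tuple_def blocks_def)
  have UN: "(\<Union>j\<in>block_index ?p. blocks j) = {1..m}"
  proof
    show "(\<Union>j\<in>block_index ?p. blocks j) \<subseteq> {1..m}"
      using block separator_subset unfolding component_def by blast
    show "{1..m} \<subseteq> (\<Union>j\<in>block_index ?p. blocks j)"
    proof
      fix i assume i: "i \<in> {1..m}"
      obtain S where S: "i \<in> S" "separator v {1..m} S" "connected_family v S"
        by (rule connected_separator_exists[OF finite_atLeastAtMost i])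
      have comp: "component v m S" using S by (auto simp: component_def)
      have sub: "S \<subseteq> {1..m}" using S(2) by (rule separator_subset)
      then have fin: "finite S" using finite_subset by blast
      have "dim (v ` S) = 1 \<or> 2 \<le> dim (v ` S) \<and> dim (v ` S) + 1 \<le> card S"
        using S v sub fin by (intro connected_family_rank) auto
      then consider "dim (v ` S) = 1" | "2 \<le> dim (v ` S)" "dim (v ` S) + 1 = card S"
        | "2 \<le> dim (v ` S)" "dim (v ` S) + 2 \<le> card S" by linarith
      then have "\<exists>j\<in>block_index ?p. blocks j = S"
      proof cases
        case 1
        then have "Inl S \<in> block_index ?p" using comp by (simp add: component_tuple_def InlI)
        then show ?thesis by (rule bexI[rotated]) (simp add: blocks_def)
      next
        case 2
        then have "Inr (Inl S) \<in> block_index ?p" using comp by (simp add: component_tuple_def InlI InrI)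
        then show ?thesis by (rule bexI[rotated]) (simp add: blocks_def)
      next
        case 3
        then have "Inr (Inr (S, dim (v ` S))) \<in> block_index ?p"
          using comp by (simp add: component_tuple_def InlI InrI)
        then show ?thesis by (rule bexI[rotated]) (simp add: blocks_def)
      qed
      then show "i \<in> (\<Union>j\<in>block_index ?p. blocks j)" using S(1) by blast
    qed
  qed
  have disj: "disjoint_family_on blocks (block_index ?p)"
    unfolding disjoint_family_on_def
  proof (intro ballI impI)
    fix j k assume jk: "j \<in> block_index ?p" "k \<in> block_index ?p" "j \<noteq> k"
    then have "blocks j \<noteq> blocks k" using inj by (auto dest: inj_onD)
    moreover have "blocks j = blocks k \<or> blocks j \<inter> blocks k = {}"
      using block[OF jk(1)] block[OF jk(2)] unfolding component_def
      by (intro connected_separators_disjoint[of "{1..m}" v]) auto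
    ultimately show "blocks j \<inter> blocks k = {}" by blast
  qed
  have "blocks ` block_index ?p \<subseteq> Pow {1..m}" using UN by blast
  then have fin: "finite (block_index ?p)"
    using inj finite_imageD finite_subset by (metis finite_Pow_iff finite_atLeastAtMost)
  have "rk ?p = (\<Sum>j\<in>block_index ?p. dim (v ` blocks j))"
    using rk_eq_sum_block_rank[OF fin] block by simp
  also have "\<dots> = dim (v ` {1..m})"
    using rank_separator_UN[of "{1..m}" "block_index ?p" v blocks] fin disj UN fits
    by (simp add: fits_def)
  finally have "rk ?p \<le> n" using n by simp
  moreover have "1 \<le> card S" if "component v m S" for S
    using that separator_subset[of v "{1..m}" S] finite_subset[of S "{1..m}"]
    by (auto simp: component_def Suc_le_eq card_gt_0_iff)
  ultimately show "?p \<in> PP n m"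
    using disj UN unfolding component_tuple_def PP_def by (auto simp del: rk.simps dim_eq_0)
qed

lemma constructible_iff_component_tuple:
  assumes F: "fst F = UNIV" and lines: "\<And>i. i \<in> {1..m} \<Longrightarrow> snd F i = span {v i} \<and> v i \<noteq> 0"
    and n: "n = dim (UNIV :: 'b set)"
  shows "p \<in> PP n m \<and> constructible scale n m p F \<longleftrightarrow> p = component_tuple v m"
proof
  have F': "is_mflag scale m F" using F lines by (simp add: is_mflag_iff)
  show "p = component_tuple v m" if "p \<in> PP n m \<and> constructible scale n m p F"
    using that constructible_imp_fits[OF _ _ F' lines] fits_eq_component_tuple by blast
  assume p: "p = component_tuple v m"
  have "dim (v ` {1..m}) \<le> n" unfolding n by (rule dim_subset) simp
  then have "p \<in> PP n m" "fits v m p" unfolding p using component_tuple_fits lines by blast+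
  then show "p \<in> PP n m \<and> constructible scale n m p F"
    using fits_imp_constructible[OF _ _ n F] lines by blast
qed

end

section \<open>Realizing a tuple by points on moment curves\<close>

text \<open>A Vandermonde argument in Lagrange form: q vanishes at all parameters except t i and has
  degree less than r. Combining the power relations with the coefficients of q leaves the single
  term c i q(t i).\<close>

lemma moment_curve_independent:
  fixes t c :: "'i \<Rightarrow> 'k::field"
  assumes "finite T" "inj_on t T" "card T \<le> r"
    and 0: "\<And>k. k < r \<Longrightarrow> (\<Sum>i\<in>T. c i * t i ^ k) = 0" and "i \<in> T"
  shows "c i = 0"
proof -
  define q where "q = (\<Prod>l\<in>T - {i}. [:- t l, 1:])"
  have "degree q \<le> (\<Sum>l\<in>T - {i}. degree [:- t l, 1:])"
    using degree_prod_sum_le[of "T - {i}" "\<lambda>l. [:- t l, 1:]"] assms(1) by (simp add: q_def o_def)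
  also have "\<dots> = card T - 1" using assms(1,5) by simp
  also have "\<dots> < card T" using assms(1,5) card_gt_0_iff[of T] by auto
  finally have deg: "degree q < r" using assms(3) by simp
  have "(\<Sum>l\<in>T. c l * poly q (t l)) = (\<Sum>l\<in>T. \<Sum>k\<le>degree q. coeff q k * (c l * t l ^ k))"
    by (simp add: poly_altdef sum_distrib_left mult_ac)
  also have "\<dots> = (\<Sum>k\<le>degree q. coeff q k * (\<Sum>l\<in>T. c l * t l ^ k))"
    by (subst sum.swap) (simp add: sum_distrib_left)
  also have "\<dots> = 0" using deg 0 by (intro sum.neutral) auto
  also have "(\<Sum>l\<in>T. c l * poly q (t l)) = (\<Sum>l\<in>{i}. c l * poly q (t l))"
    using assms(1,5) by (intro sum.mono_neutral_right) (auto simp: q_def poly_prod)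
  finally have "c i * poly q (t i) = 0" by simp
  moreover have "poly q (t i) \<noteq> 0"
    using assms(1,2,5) by (auto simp: q_def poly_prod dest: inj_onD)
  ultimately show ?thesis by simp
qed

interpretation flag: flag_space "(*s) :: 'k::field \<Rightarrow> 'k^'n \<Rightarrow> 'k^'n" cart_basis
  by (simp add: flag_space_def vec.finite_dimensional_vector_space_axioms)

text \<open>
  Each block gets its own coordinates e (j, k), and its vectors are the points of the moment curve
  of dimension block_rank j. Any block_rank j of them are independent, while block_rank j + 1 of them,
  chosen to meet both sides of a supposed separator, satisfy a non-trivial relation; restricted to
  either side it would involve at most block_rank j vectors.
\<close>

lemma fits_exists:
  assumes p: "p \<in> PP CARD('n) m"
  obtains v :: "nat \<Rightarrow> 'k::field_char_0^'n" where "\<forall>i\<in>{1..m}. v i \<noteq> 0" "flag.fits v m p"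
proof -
  let ?J = "block_index p"
  let ?D = "SIGMA j:?J. {..<block_rank j}"
  have fin: "finite ?J" by (rule PP_finite[OF p])
  \<comment> \<open>There is room for separate coordinates because the pairs (j, k) number
    \<open>rk p\<close>.\<close>
  have "card ?D \<le> CARD('n)" using fin PP_rk[OF p] PP_rk_le[OF p] by simp
  then obtain e :: "_ \<Rightarrow> 'n" where e: "inj_on e ?D"
    using card_le_inj[of ?D "UNIV :: 'n set"] fin by auto
  define idx where "idx i = (THE j. j \<in> ?J \<and> i \<in> blocks j)" for i
  have idx: "idx i = j" if "j \<in> ?J" "i \<in> blocks j" for i j
    unfolding idx_def using that PP_disjoint[OF p]
    by (intro the_equality) (auto simp: disjoint_family_on_def)
  have idx_mem: "idx i \<in> ?J \<and> i \<in> blocks (idx i)" if "i \<in> {1..m}" for i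
  proof -
    have "i \<in> (\<Union>j\<in>?J. blocks j)" using that PP_UN[OF p] by simp
    then obtain j where "j \<in> ?J" "i \<in> blocks j" by (rule UN_E)
    then show ?thesis using idx by simp
  qed
  \<comment> \<open>The parameter of index i is i itself; characteristic zero keeps the parameters
    distinct. Exponents start at 0, so each vector has an entry 1 in its block, whose rank is at
    least 1.\<close>
  define v :: "nat \<Rightarrow> 'k^'n" where
    "v i = (\<chi> x. if x \<in> e ` ?D \<and> fst (inv_into ?D e x) = idx i then of_nat i ^ snd (inv_into ?D e x) else 0)" for i
  have v_e: "v i $ e (j, k) = (if j = idx i then of_nat i ^ k else 0)" if "j \<in> ?J" "k < block_rank j" for i j k
  proof -
    have "(j, k) \<in> ?D" using that by simp
    then show ?thesis using inv_into_f_f[OF e, of "(j, k)"] by (auto simp: v_def)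
  qed
  have v_out: "v i $ x = 0" if "x \<notin> e ` ?D" for i x
    using that by (simp add: v_def)
  have rel: "(\<Sum>i\<in>T. c i *s v i) = 0 \<longleftrightarrow>
      (\<forall>j\<in>?J. \<forall>k<block_rank j. (\<Sum>i\<in>T. c i * (if j = idx i then of_nat i ^ k else 0)) = 0)" for T c
  proof -
    have "(\<Sum>i\<in>T. c i *s v i) = 0 \<longleftrightarrow> (\<forall>x. (\<Sum>i\<in>T. c i * v i $ x) = 0)"
      by (simp add: vec_eq_iff sum_component)
    also have "\<dots> \<longleftrightarrow> (\<forall>x\<in>e ` ?D. (\<Sum>i\<in>T. c i * v i $ x) = 0)"
      using v_out by fastforce
    also have "\<dots> \<longleftrightarrow> (\<forall>j\<in>?J. \<forall>k<block_rank j. (\<Sum>i\<in>T. c i * v i $ e (j, k)) = 0)" by auto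
    finally show ?thesis by (simp add: v_e cong: ball_cong)
  qed
  have rel_block: "(\<Sum>i\<in>T. c i *s v i) = 0 \<longleftrightarrow> (\<forall>k<block_rank j. (\<Sum>i\<in>T. c i * of_nat i ^ k) = 0)"
    if j: "j \<in> ?J" "T \<subseteq> blocks j" for T c j
  proof -
    have "idx i = j" if "i \<in> T" for i using idx j that by blast
    then have "(\<Sum>i\<in>T. c i * (if l = idx i then of_nat i ^ k else 0)) =
        (if l = j then \<Sum>i\<in>T. c i * of_nat i ^ k else 0)" for l k
      by (cases "l = j") (auto intro!: sum.cong sum.neutral)
    then show ?thesis unfolding rel using j(1) by auto
  qed
  have block_sub: "blocks j \<subseteq> {1..m}" if "j \<in> ?J" for j
    using PP_UN[OF p] that by blast
  have block_fin: "finite (blocks j)" if "j \<in> ?J" for j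
    using block_sub[OF that] finite_subset by blast
  have indep: "flag.independent_family v T" if j: "j \<in> ?J" "T \<subseteq> blocks j" "card T \<le> block_rank j" for j T
    unfolding flag.independent_family_def
  proof (intro allI impI ballI)
    fix c i assume c: "(\<Sum>i\<in>T. c i *s v i) = 0" and i: "i \<in> T"
    show "c i = 0"
    proof (rule moment_curve_independent[where t = of_nat, OF _ _ j(3) _ i])
      show "finite T" by (rule finite_subset[OF j(2) block_fin[OF j(1)]])
      show "inj_on (of_nat :: nat \<Rightarrow> 'k) T" by (simp add: inj_on_def)
      show "(\<Sum>i\<in>T. c i * of_nat i ^ k) = 0" if "k < block_rank j" for k
        using rel_block[OF j(1,2), THEN iffD1, OF c] that by blast
    qed
  qed
  have rank: "vec.dim (v ` blocks j) = block_rank j" if j: "j \<in> ?J" for j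
  proof (rule antisym)
    let ?E = "(\<lambda>k. axis (e (j, k)) 1 :: 'k^'n) ` {..<block_rank j}"
    \<comment> \<open>Upper bound for the rank: the block lies in the span of its own
      \<open>block_rank j\<close> coordinate axes.\<close>
    have "v i = (\<Sum>k<block_rank j. of_nat i ^ k *s axis (e (j, k)) 1)" if i: "i \<in> blocks j" for i
    proof (rule vec_eq_iff[THEN iffD2], rule allI)
      fix x
      have "(\<Sum>k<block_rank j. of_nat i ^ k *s axis (e (j, k)) 1 :: 'k^'n) $ x
          = (\<Sum>k<block_rank j. if x = e (j, k) then of_nat i ^ k else 0)"
        by (simp add: sum_component axis_def if_distrib cong: if_cong)
      also have "\<dots> = v i $ x"
      proof (cases "\<exists>k<block_rank j. x = e (j, k)")
        case True
        then obtain k where k: "k < block_rank j" "x = e (j, k)" by blast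
        have "x = e (j, l) \<longleftrightarrow> l = k" if "l < block_rank j" for l
          using k that j e by (auto dest: inj_onD)
        then have "(\<Sum>l<block_rank j. if x = e (j, l) then of_nat i ^ l else 0 :: 'k)
            = (\<Sum>l<block_rank j. if l = k then of_nat i ^ l else 0)" by (intro sum.cong) auto
        then show ?thesis using k v_e[OF j k(1)] idx[OF j i] by simp
      next
        case False
        have "v i $ x = 0"
        proof (cases "x \<in> e ` ?D")
          case True
          then obtain l k where lk: "l \<in> ?J" "k < block_rank l" "x = e (l, k)" by auto
          then have "l \<noteq> j" using False by blast
          then show ?thesis using v_e[OF lk(1,2)] lk(3) idx[OF j i] by simp
        qed (rule v_out)
        then show ?thesis using False by (auto intro!: sum.neutral)
      qed
      finally show "v i $ x = (\<Sum>k<block_rank j. of_nat i ^ k *s axis (e (j, k)) 1) $ x" by simp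
    qed
    then have "v ` blocks j \<subseteq> vec.span ?E"
      by (auto intro!: vec.span_sum vec.span_scale intro: vec.span_base)
    then have "vec.dim (v ` blocks j) \<le> card ?E" by (rule vec.dim_le_card) simp
    also have "\<dots> \<le> block_rank j" using card_image_le[of "{..<block_rank j}"] by simp
    finally show "vec.dim (v ` blocks j) \<le> block_rank j" .
    have "block_rank j \<le> card (blocks j)"
      using PP_block[OF p j] block_fin[OF j] by (auto simp: Suc_le_eq card_gt_0_iff)
    then obtain T where T: "T \<subseteq> blocks j" "card T = block_rank j"
      using obtain_subset_with_card_n by metis
    have "vec.dim (v ` T) = block_rank j"
      using flag.independent_family_rank[OF _ indep[OF j T(1)]] T finite_subset[OF T(1) block_fin[OF j]]
      by simp
    moreover have "vec.dim (v ` T) \<le> vec.dim (v ` blocks j)"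
      using T(1) by (intro vec.dim_subset) auto
    ultimately show "block_rank j \<le> vec.dim (v ` blocks j)" by simp
  qed
  have sep: "flag.separator v {1..m} (blocks j)" if j: "j \<in> ?J" for j
    unfolding flag.separator_def
  proof (intro conjI allI impI)
    show "blocks j \<subseteq> {1..m}" by (rule block_sub[OF j])
    fix c assume c: "(\<Sum>i\<in>{1..m}. c i *s v i) = 0"
    have "(\<Sum>i\<in>blocks j. c i * of_nat i ^ k) = 0" if "k < block_rank j" for k
    proof -
      have "(\<Sum>i\<in>blocks j. c i * of_nat i ^ k) = (\<Sum>i\<in>blocks j. c i * (if j = idx i then of_nat i ^ k else 0))"
        using idx[OF j] by (intro sum.cong) auto
      also have "\<dots> = (\<Sum>i\<in>{1..m}. c i * (if j = idx i then of_nat i ^ k else 0))"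
        using block_sub[OF j] idx_mem by (intro sum.mono_neutral_left) auto
      also have "\<dots> = 0" using c j that unfolding rel by blast
      finally show ?thesis .
    qed
    then show "(\<Sum>i\<in>blocks j. c i *s v i) = 0" unfolding rel_block[OF j subset_refl] by blast
  qed
  have con: "flag.connected_family v (blocks j)" if j: "j \<in> ?J" for j
    unfolding flag.connected_family_def
  proof (intro allI impI, rule ccontr)
    fix T assume T: "flag.separator v (blocks j) T" and "\<not> (T = {} \<or> T = blocks j)"
    moreover have TS: "T \<subseteq> blocks j" using T by (rule flag.separator_subset)
    ultimately obtain a b where ab: "a \<in> T" "b \<in> blocks j" "b \<notin> T" by blast
    then have "a \<noteq> b" by blast
    then have ab2: "card {a, b} = 2" "{a, b} \<subseteq> blocks j" using ab TS by auto
    then have "2 \<le> card (blocks j)" using card_mono[OF block_fin[OF j] ab2(2)] by simp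
    \<comment> \<open>With two distinct indices in the block, the alternative of rank 1 satisfies
      this bound too.\<close>
    then have le: "block_rank j + 1 \<le> card (blocks j)" using PP_block[OF p j] by auto
    then have "block_rank j - 1 \<le> card (blocks j - {a, b})"
      using ab2 block_fin[OF j] by (simp add: card_Diff_subset)
    then obtain C0 where C0: "C0 \<subseteq> blocks j - {a, b}" "card C0 = block_rank j - 1" "finite C0"
      using obtain_subset_with_card_n by metis
    define C where "C = C0 \<union> {a, b}"
    have C: "C \<subseteq> blocks j" "finite C" "a \<in> C" "b \<in> C" using C0 ab2 by (auto simp: C_def)
    have "card C = card C0 + card {a, b}"
      unfolding C_def using C0 by (intro card_Un_disjoint) auto
    then have cardC: "card C = block_rank j + 1" using C0(2) ab2(1) PP_block[OF p j] by simp
    have "vec.dim (v ` C) \<le> vec.dim (v ` blocks j)" using C(1) by (intro vec.dim_subset) auto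
    then have "\<not> flag.independent_family v C"
      using flag.independent_family_rank[OF C(2), of v] rank[OF j] cardC by auto
    then obtain c i where c: "(\<Sum>i\<in>C. c i *s v i) = 0" "i \<in> C" "c i \<noteq> 0"
      unfolding flag.independent_family_def by blast
    have sepC: "flag.separator v C (T \<inter> C)" by (rule flag.separator_Int[OF block_fin[OF j] T C(1)])
    have zero: "c l = 0" if U: "flag.separator v C U" "U \<noteq> C" and l: "l \<in> U" for U l
    proof -
      have "card U < card C" using U flag.separator_subset[OF U(1)] C(2) by (intro psubset_card_mono) auto
      then have "flag.independent_family v U"
        using cardC flag.separator_subset[OF U(1)] C(1) by (intro indep[OF j]) auto
      moreover have "(\<Sum>i\<in>U. c i *s v i) = 0" by (rule flag.separatorD[OF U(1) c(1)])
      ultimately show ?thesis using l unfolding flag.independent_family_def by blast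
    qed
    \<comment> \<open>The index i with c i \<noteq> 0 lies on one of the two sides; b shows that the
      side in T is proper, and a shows the same for the other side.\<close>
    show False
    proof (cases "i \<in> T")
      case True
      then show False using zero[OF sepC] ab C c by blast
    next
      case False
      then show False using zero[OF flag.separator_Diff[OF C(2) sepC]] ab C c by blast
    qed
  qed
  have "v i \<noteq> 0" if i: "i \<in> {1..m}" for i
  proof
    assume "v i = 0"
    moreover have "v i $ e (idx i, 0) = 1"
      using v_e[of "idx i" 0 i] idx_mem[OF i] PP_block[OF p, of "idx i"] by simp
    ultimately show False by simp
  qed
  moreover have "flag.fits v m p" using sep con rank by (simp add: flag.fits_def)
  ultimately show thesis by (intro that ballI)
qed

section \<open>Cosets and diagonal orbits\<close>

lemma carrier_GLm: "carrier (GLm m) = (\<Pi>\<^sub>E i\<in>{1..m}. {A. invertible A})"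
  by (simp add: GLm_def GL_def)

lemma mult_GLm: "a \<otimes>\<^bsub>GLm m\<^esub> b = (\<lambda>i\<in>{1..m}. a i ** b i)"
  by (simp add: GLm_def GL_def)

lemma is_line_span:
  assumes "is_line L"
  obtains l where "l \<noteq> 0" "L = vec.span {l}"
proof -
  have "vec.dim L \<noteq> 0" using assms by simp
  then obtain l where "l \<in> L" "l \<noteq> 0" unfolding vec.dim_eq_0 by blast
  with assms that show thesis using flag.line_eq_span by blast
qed

lemma matrix_image_line: "(*v) A ` vec.span {x} = vec.span {A *v x}"
  for A :: "'k::field^'n^'n"
  using vec.span_image[of A "{x}"] by simp

lemma invertible_mat_1: "invertible (mat 1 :: 'k::field^'n^'n)"
  unfolding invertible_def by (rule exI[of _ "mat 1"]) simp

lemma invertible_mult_eq_0_iff: "invertible A \<Longrightarrow> A *v x = 0 \<longleftrightarrow> x = 0"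
  for A :: "'k::field^'n^'n"
  by (metis invertible_eq_bij bij_is_inj injD matrix_vector_mult_0_right)

text \<open>The assignment of y to x extends to an injective endomorphism, which in finite dimension
  is bijective.\<close>

lemma invertible_transitive:
  fixes x y :: "'k::field^'n"
  assumes "x \<noteq> 0" "y \<noteq> 0"
  obtains A :: "'k^'n^'n" where "invertible A" "A *v x = y"
proof -
  obtain g where g: "Vector_Spaces.linear (*s) (*s) g" "inj g" "g x = y"
    using vec.linear_independent_extend_inj[of "{x}" "\<lambda>_. y"] assms by auto
  have "surj g" using g(1,2) by (rule vec.linear_inj_imp_surj)
  moreover have eq: "(*v) (matrix g) = g" by (rule ext) (rule matrix_works[OF g(1)])
  ultimately have "bij ((*v) (matrix g))" using g(2) by (simp add: bij_def)
  with that[of "matrix g"] g(3) eq show thesis by (simp add: invertible_eq_bij)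
qed

lemma GmPm_iff:
  "F \<in> GmPm m L \<longleftrightarrow> (\<exists>a\<in>carrier (GLm m). F = a <#\<^bsub>GLm m\<^esub> (\<Pi>\<^sub>E i\<in>{1..m}. Par L))"
  by (simp only: GmPm_def LCOSETS_def UN_iff singleton_iff)

lemma GmPmE:
  assumes "F \<in> GmPm m L"
  obtains a where "a \<in> carrier (GLm m)" "F = a <#\<^bsub>GLm m\<^esub> (\<Pi>\<^sub>E i\<in>{1..m}. Par L)"
  using assms unfolding GmPm_iff by (rule bexE)

text \<open>Besides supplying a representative, this shows that the coset is non-empty, so the union
  of equal lines in \<open>coset_mflag\<close> is that line.\<close>

lemma coset_self:
  assumes a: "a \<in> carrier (GLm m)"
  shows "a \<in> a <#\<^bsub>GLm m\<^esub> (\<Pi>\<^sub>E i\<in>{1..m}. Par L)"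
proof -
  have "mat 1 \<in> Par L" by (simp add: Par_def GL_def invertible_mat_1)
  then have "(\<lambda>i\<in>{1..m}. mat 1) \<in> (\<Pi>\<^sub>E i\<in>{1..m}. Par L)" by simp
  moreover have "a \<otimes>\<^bsub>GLm m\<^esub> (\<lambda>i\<in>{1..m}. mat 1) = a"
    using PiE_restrict[OF a[unfolded carrier_GLm]] by (simp add: mult_GLm cong: restrict_cong)
  ultimately show ?thesis unfolding l_coset_def by (metis UN_I singletonI)
qed

lemma coset_mflag_lines:
  assumes a: "a \<in> carrier (GLm m)" and i: "i \<in> {1..m}"
  shows "g \<in> a <#\<^bsub>GLm m\<^esub> (\<Pi>\<^sub>E i\<in>{1..m}. Par L) \<Longrightarrow> (*v) (g i) ` L = (*v) (a i) ` L"
    and "snd (coset_mflag L (a <#\<^bsub>GLm m\<^esub> (\<Pi>\<^sub>E i\<in>{1..m}. Par L))) i = (*v) (a i) ` L"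
proof -
  let ?F = "a <#\<^bsub>GLm m\<^esub> (\<Pi>\<^sub>E i\<in>{1..m}. Par L)"
  show *: "(*v) (g i) ` L = (*v) (a i) ` L" if g: "g \<in> ?F" for g
  proof -
    obtain h where h: "h \<in> (\<Pi>\<^sub>E i\<in>{1..m}. Par L)" "g = a \<otimes>\<^bsub>GLm m\<^esub> h"
      using g unfolding l_coset_def by blast
    from h(1) have "h i \<in> Par L" using i by (rule PiE_mem)
    then have "(*v) (h i) ` L = L" by (simp add: Par_def)
    moreover have "g i = a i ** h i" using h(2) i by (simp add: mult_GLm)
    then have "(*v) (g i) ` L = (*v) (a i) ` ((*v) (h i) ` L)"
      by (simp add: image_image matrix_vector_mul_assoc)
    ultimately show ?thesis by simp
  qed
  have "snd (coset_mflag L ?F) i = (\<Union>g\<in>?F. (*v) (g i) ` L)" by (simp add: coset_mflag_def)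
  also have "\<dots> = (\<Union>g\<in>?F. (*v) (a i) ` L)" using * by (intro SUP_cong) auto
  also have "\<dots> = (*v) (a i) ` L" using coset_self[OF a] by blast
  finally show "snd (coset_mflag L ?F) i = (*v) (a i) ` L" .
qed

lemma coset_mflag_vectors:
  assumes "is_line L" "F \<in> GmPm m L"
  obtains v where "\<forall>i\<in>{1..m}. snd (coset_mflag L F) i = vec.span {v i} \<and> v i \<noteq> 0"
proof -
  obtain l where l: "l \<noteq> 0" "L = vec.span {l}" using assms(1) by (rule is_line_span)
  obtain a where a: "a \<in> carrier (GLm m)" "F = a <#\<^bsub>GLm m\<^esub> (\<Pi>\<^sub>E i\<in>{1..m}. Par L)"
    using assms(2) by (rule GmPmE)
  have "snd (coset_mflag L F) i = vec.span {a i *v l} \<and> a i *v l \<noteq> 0" if i: "i \<in> {1..m}" for i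
  proof -
    have "invertible (a i)" using PiE_mem[OF a(1)[unfolded carrier_GLm] i] by simp
    then show ?thesis
      using coset_mflag_lines(2)[OF a(1) i] a(2) l by (simp add: matrix_image_line invertible_mult_eq_0_iff)
  qed
  then show thesis by (intro that ballI)
qed

text \<open>The m factors of the group act independently, so transitivity on non-zero vectors can be
  used for each line separately.\<close>

lemma coset_mflag_surj:
  assumes "is_line L" and v: "\<And>i. i \<in> {1..m} \<Longrightarrow> v i \<noteq> 0"
  obtains F where "F \<in> GmPm m L" "\<forall>i\<in>{1..m}. snd (coset_mflag L F) i = vec.span {v i}"
proof -
  obtain l where l: "l \<noteq> 0" "L = vec.span {l}" using assms(1) by (rule is_line_span)
  have "\<forall>i\<in>{1..m}. \<exists>A. invertible A \<and> A *v l = v i"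
    using invertible_transitive[OF l(1)] v by metis
  then obtain A where A: "\<forall>i\<in>{1..m}. invertible (A i) \<and> A i *v l = v i" by metis
  let ?a = "\<lambda>i\<in>{1..m}. A i"
  have a: "?a \<in> carrier (GLm m)" using A by (simp add: carrier_GLm)
  show thesis
  proof (rule that)
    show "?a <#\<^bsub>GLm m\<^esub> (\<Pi>\<^sub>E i\<in>{1..m}. Par L) \<in> GmPm m L"
      using a unfolding GmPm_iff by (rule bexI[rotated]) simp
    show "\<forall>i\<in>{1..m}. snd (coset_mflag L (?a <#\<^bsub>GLm m\<^esub> (\<Pi>\<^sub>E i\<in>{1..m}. Par L))) i = vec.span {v i}"
      using coset_mflag_lines(2)[OF a] A l by (simp add: matrix_image_line)
  qed
qed

lemma diag_orbit_iff:
  "g \<in> diag_orbit m F \<longleftrightarrow>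
     (\<exists>A. invertible A \<and> (\<exists>f\<in>F. g = (\<lambda>i\<in>{1..m}. A) \<otimes>\<^bsub>GLm m\<^esub> f))"
  unfolding diag_orbit_def set_mult_def diagGL_def GL_def UN_iff singleton_iff bex_simps
  by simp

text \<open>A representative of F' lies in the orbit of F, hence is A times an element of F with one
  matrix A for all indices; multiplication by A is the isomorphism.\<close>

lemma diag_orbit_eq_imp_iso:
  assumes "F \<in> GmPm m L" "F' \<in> GmPm m L" and orbit: "diag_orbit m F = diag_orbit m F'"
  shows "mflag_iso (*s) (*s) m (coset_mflag L F') (coset_mflag L F)"
proof -
  obtain a where a: "a \<in> carrier (GLm m)" "F = a <#\<^bsub>GLm m\<^esub> (\<Pi>\<^sub>E i\<in>{1..m}. Par L)"
    using assms(1) by (rule GmPmE)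
  obtain a' where a': "a' \<in> carrier (GLm m)" "F' = a' <#\<^bsub>GLm m\<^esub> (\<Pi>\<^sub>E i\<in>{1..m}. Par L)"
    using assms(2) by (rule GmPmE)
  have "a' \<in> F'" using coset_self[OF a'(1)] a'(2) by simp
  moreover have "(\<lambda>i\<in>{1..m}. mat 1) \<otimes>\<^bsub>GLm m\<^esub> a' = a'"
    using PiE_restrict[OF a'(1)[unfolded carrier_GLm]] by (simp add: mult_GLm cong: restrict_cong)
  ultimately have "a' \<in> diag_orbit m F'"
    unfolding diag_orbit_iff by (intro exI[of _ "mat 1"] conjI invertible_mat_1 bexI[of _ a']) simp_all
  then have "a' \<in> diag_orbit m F" using orbit by simp
  then obtain A f where A: "invertible A" and f: "f \<in> F" and "a' = (\<lambda>i\<in>{1..m}. A) \<otimes>\<^bsub>GLm m\<^esub> f"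
    unfolding diag_orbit_iff by (elim exE conjE bexE) (rule that)
  then have af: "\<forall>i\<in>{1..m}. a' i = A ** f i" by (simp add: mult_GLm)
  have "(*v) A ` snd (coset_mflag L F) i = snd (coset_mflag L F') i" if i: "i \<in> {1..m}" for i
  proof -
    have "(*v) A ` snd (coset_mflag L F) i = (*v) A ` ((*v) (f i) ` L)"
      using coset_mflag_lines[OF a(1) i] f a(2) by simp
    also have "\<dots> = (*v) (a' i) ` L" using af i by (simp add: image_image matrix_vector_mul_assoc)
    finally show ?thesis using coset_mflag_lines(2)[OF a'(1) i] a'(2) by simp
  qed
  moreover have "bij ((*v) A)" using A by (simp add: invertible_eq_bij)
  ultimately show ?thesis
    by (intro mflag_isoI[where g = "(*v) A"])
      (auto simp: coset_mflag_def matrix_vector_right_distrib vector_scalar_commute)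
qed

section \<open>Descent to orbits and the classification\<close>

lemma constructible_iso:
  assumes "constructible s n m p F" "mflag_iso s s m F' F" "\<And>i. i \<in> {1..m} \<Longrightarrow> snd F' i \<subseteq> fst F'"
  shows "constructible s n m p F'"
  using assms mflag_iso_trans[OF assms(2) _ assms(3)] unfolding constructible_iff by metis

text \<open>Stated over a field of characteristic zero, so that one proof serves the real and the
  complex case.\<close>

lemma constructible_classification:
  fixes L :: "('k::field_char_0^'n) set"
  assumes n: "n = CARD('n)" and L: "is_line L"
  shows "(\<forall>F\<in>GmPm m L. \<exists>!p. p \<in> PP n m \<and> constructible (*s) n m p (coset_mflag L F)) \<and>
      (\<exists>\<pi> \<in> diag_quot m L \<rightarrow> PP n m.
         (\<forall>F\<in>GmPm m L. constructible (*s) n m (\<pi> (diag_orbit m F)) (coset_mflag L F)) \<and>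
         \<pi> ` diag_quot m L = PP n m)"
proof -
  let ?con = "\<lambda>p F. p \<in> PP n m \<and> constructible (*s) n m p (coset_mflag L F)"
  have dim: "n = vec.dim (UNIV :: ('k^'n) set)" using n by (simp add: vec.dim_UNIV card_cart_basis)
  have UNIV: "fst (coset_mflag L F) = UNIV" for F by (simp add: coset_mflag_def)
  have unique: "\<exists>!p. ?con p F" if F: "F \<in> GmPm m L" for F
  proof -
    obtain v where v: "\<forall>i\<in>{1..m}. snd (coset_mflag L F) i = vec.span {v i} \<and> v i \<noteq> 0"
      by (rule coset_mflag_vectors[OF L F])
    have "?con p F \<longleftrightarrow> p = flag.component_tuple v m" for p
      by (rule flag.constructible_iff_component_tuple[OF UNIV v[rule_format] dim])
    then show ?thesis by (intro ex1I[of _ "flag.component_tuple v m"]) blast+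
  qed
  \<comment> \<open>An orbit is only a union of cosets, so a representative is chosen; the choice is
    harmless because cosets with the same orbit give isomorphic flags and constructibility is
    invariant under isomorphism.\<close>
  define \<pi> where "\<pi> Q = (THE p. ?con p (SOME F. F \<in> GmPm m L \<and> diag_orbit m F = Q))" for Q
  have \<pi>: "?con (\<pi> (diag_orbit m F)) F" if F: "F \<in> GmPm m L" for F
  proof -
    define F' where "F' = (SOME F'. F' \<in> GmPm m L \<and> diag_orbit m F' = diag_orbit m F)"
    have F': "F' \<in> GmPm m L \<and> diag_orbit m F' = diag_orbit m F"
      unfolding F'_def by (rule someI[of _ F]) (simp add: F)
    have con: "?con (\<pi> (diag_orbit m F)) F'"
      unfolding \<pi>_def F'_def[symmetric] by (intro theI'[OF unique] conjunct1[OF F'])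
    have iso: "mflag_iso (*s) (*s) m (coset_mflag L F) (coset_mflag L F')"
      using F' by (intro diag_orbit_eq_imp_iso F) simp_all
    have "constructible (*s) n m (\<pi> (diag_orbit m F)) (coset_mflag L F)"
      by (rule constructible_iso[OF conjunct2[OF con] iso]) (simp add: UNIV)
    with con show ?thesis by simp
  qed
  have "\<pi> ` diag_quot m L = PP n m"
  proof
    show "\<pi> ` diag_quot m L \<subseteq> PP n m" using \<pi> by (auto simp: diag_quot_def)
    show "PP n m \<subseteq> \<pi> ` diag_quot m L"
    proof
      fix p assume p: "p \<in> PP n m"
      obtain v :: "nat \<Rightarrow> 'k^'n" where v: "\<forall>i\<in>{1..m}. v i \<noteq> 0" "flag.fits v m p"
        by (rule fits_exists[OF p[unfolded n]])
      obtain F where F: "F \<in> GmPm m L" "\<forall>i\<in>{1..m}. snd (coset_mflag L F) i = vec.span {v i}"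
        by (rule coset_mflag_surj[OF L v(1)[rule_format]])
      have "?con p F" using flag.fits_imp_constructible[OF p v(2) dim UNIV F(2)[rule_format]] p by simp
      then have "p = \<pi> (diag_orbit m F)" using \<pi>[OF F(1)] unique[OF F(1)] by blast
      then show "p \<in> \<pi> ` diag_quot m L" using F(1) by (auto simp: diag_quot_def)
    qed
  qed
  then show ?thesis using unique \<pi> by blast
qed

theorem theorem2p2:
  fixes n m :: nat
    and LR :: "(real^'n) set" and LC :: "(complex^'n) set"
  assumes "n = CARD('n)" and "2 \<le> n" and "1 \<le> m"
    and "is_line LR" and "is_line LC"
  shows
    "((\<forall>F\<in>GmPm m LR. \<exists>!p. p \<in> PP n m \<and> constructible (*s) n m p (coset_mflag LR F)) \<and>
      (\<exists>\<pi> \<in> diag_quot m LR \<rightarrow> PP n m.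
         (\<forall>F\<in>GmPm m LR. constructible (*s) n m (\<pi> (diag_orbit m F)) (coset_mflag LR F)) \<and>
         \<pi> ` diag_quot m LR = PP n m)) \<and>
     ((\<forall>F\<in>GmPm m LC. \<exists>!p. p \<in> PP n m \<and> constructible (*s) n m p (coset_mflag LC F)) \<and>
      (\<exists>\<pi> \<in> diag_quot m LC \<rightarrow> PP n m.
         (\<forall>F\<in>GmPm m LC. constructible (*s) n m (\<pi> (diag_orbit m F)) (coset_mflag LC F)) \<and>
         \<pi> ` diag_quot m LC = PP n m))"
  using constructible_classification[OF assms(1,4)] constructible_classification[OF assms(1,5)]
  by (rule conjI)

end
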